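(* Let $p\in(-1,0]$, $\alpha\in(0,1)$, and let $f\in C^\alpha(\mathbb{S}^1)$ be positive. Then there exists a constant $C_{p,f}\ge 1$, depending only on $p$, $\min_{\mathbb{S}^1} f$ and $\|f\|_{C^\alpha(\mathbb{S}^1)}$, such that $$C_{p,f}^{-1}\le h\le C_{p,f}\quad\text{on }\mathbb{S}^1$$ holds for all positive classical solutions $h$ of $$h_{\theta\theta}+h=f\,h^{p-1}\quad\text{on }\mathbb{S}^1.$$ Consequently, for each positive function $f\in C^\alpha(\mathbb{S}^1)$ there exists at least one positive classical solution of this equation.
   Context: $\mathbb{S}^1$ is the unit circle with arc-length parameter $\theta$; functions on $\mathbb{S}^1$ are identified with $2\pi$-periodic functions of $\theta$. A positive classical solution is a function $h\in C^{2,\alpha}(\mathbb{S}^1)$ with $h>0$ everywhere satisfying the equation pointwise. *)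

theory Defs
  imports "HOL-Analysis.Analysis" "HOL-Library.Periodic_Fun"
begin

text \<open>Functions on the unit circle are \<open>2 * pi\<close>-periodic functions of the arc-length
  parameter, defined on all of \<open>real\<close>.\<close>

abbreviation circle_fun :: "(real \<Rightarrow> real) \<Rightarrow> bool" where
  "circle_fun f \<equiv> periodic_fun_simple f (2 * pi)"

text \<open>Measuring distances on the line gives the same Hoelder condition and the same
  seminorm as the geodesic distance of the circle: the latter is the least distance between
  representatives of the two points, so periodic functions have the same supremum for both.\<close>

definition holder :: "real \<Rightarrow> (real \<Rightarrow> real) \<Rightarrow> bool" where
  "holder \<alpha> f \<longleftrightarrow>
     circle_fun f \<and> (\<exists>K. \<forall>x y. \<bar>f x - f y\<bar> \<le> K * \<bar>x - y\<bar> powr \<alpha>)"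

definition holder_seminorm :: "real \<Rightarrow> (real \<Rightarrow> real) \<Rightarrow> real" where
  "holder_seminorm \<alpha> f =
     (SUP (x, y)\<in>{(x, y). x \<noteq> y}. \<bar>f x - f y\<bar> / \<bar>x - y\<bar> powr \<alpha>)"

definition holder_norm :: "real \<Rightarrow> (real \<Rightarrow> real) \<Rightarrow> real" where
  "holder_norm \<alpha> f = (SUP x. \<bar>f x\<bar>) + holder_seminorm \<alpha> f"

text \<open>For a continuous function on the circle the infimum below is attained.\<close>

definition circle_min :: "(real \<Rightarrow> real) \<Rightarrow> real" where
  "circle_min f = (INF x. f x)"

text \<open>The space \<open>C\<^sup>2\<^sup>,\<^sup>\<alpha>\<close> of the circle; continuity of \<open>h\<close>, \<open>deriv h\<close> and
  periodicity of the derivatives are automatic.\<close>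

definition C2_holder :: "real \<Rightarrow> (real \<Rightarrow> real) \<Rightarrow> bool" where
  "C2_holder \<alpha> h \<longleftrightarrow>
     circle_fun h \<and> (\<forall>\<theta>. h differentiable at \<theta>) \<and> (\<forall>\<theta>. deriv h differentiable at \<theta>) \<and>
     holder \<alpha> (deriv (deriv h))"

definition positive_classical_solution ::
    "real \<Rightarrow> real \<Rightarrow> (real \<Rightarrow> real) \<Rightarrow> (real \<Rightarrow> real) \<Rightarrow> bool" where
  "positive_classical_solution p \<alpha> f h \<longleftrightarrow>
     C2_holder \<alpha> h \<and> (\<forall>\<theta>. h \<theta> > 0) \<and>
     (\<forall>\<theta>. deriv (deriv h) \<theta> + h \<theta> = f \<theta> * h \<theta> powr (p - 1))"

end

theory Submission
  imports Defs
begin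

text \<open>
  Only bounds \<open>m \<le> f \<le> M\<close> enter the estimate. Suppose that a solution has a very deep local
  minimum (a valley). It leaves the valley at high speed \<open>y\<close>, follows approximately the arch
  \<open>y * sin\<close>, returns at comparable speed and so enters another deep valley. Testing
  \<open>h'' + h = f * h powr (p - 1)\<close> with \<open>sin\<close> along the arch yields a term of order
  \<open>y powr (p - 1)\<close>, which for \<open>p > -1\<close> dominates the two minimal values; this forces
  consecutive deep valleys to be more than \<open>pi\<close>, but less than \<open>2 * pi\<close>, apart. Two such
  gaps do not fit into one period, so the minimum of \<open>h\<close> is bounded below. Then the right-hand
  side is bounded, and comparing \<open>h\<close> with \<open>cos\<close> between a maximum and the point half a
  period later bounds it above.

  For existence, periodic solutions are the fixed points of the time \<open>2 * pi\<close> map of the flow on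
  initial data. The estimate, applied to \<open>(1 - s) * f + s\<close>, excludes fixed points with large
  energy for all \<open>s\<close> at once. For \<open>s = 1\<close> the energy is conserved, so the convex sublevel
  set of the energy is mapped into itself, and a homotopy argument based on Brouwer's theorem yields a
  fixed point for \<open>s = 0\<close>.
\<close>

section \<open>The truncated power\<close>

text \<open>The power is continued affinely below the cut-off \<open>e\<close>, so that the equation becomes globally
  Lipschitz. The slope \<open>- e powr (p - 2)\<close> is steep enough to push a solution that has become
  small or negative back up in a time much shorter than \<open>pi\<close>.\<close>

definition trunc_powr :: "real \<Rightarrow> real \<Rightarrow> real \<Rightarrow> real" where
  "trunc_powr p e x = (if x \<ge> e then x powr (p - 1) else e powr (p - 2) * (2 * e - x))"

lemma trunc_powr_pos: "0 < e \<Longrightarrow> 0 < trunc_powr p e x"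
  by (auto simp: trunc_powr_def)

lemma trunc_powr_split:
  assumes "0 < e" "x < e"
  shows "trunc_powr p e x = e powr (p - 1) + e powr (p - 2) * (e - x)"
proof -
  have "e powr (p - 1) = e powr (p - 2) * e"
    using assms powr_add[of e "p - 2" 1] by simp
  thus ?thesis using assms by (simp add: trunc_powr_def algebra_simps)
qed

lemma powr_le_powr_small:
  fixes x :: real assumes "0 < x" "x \<le> 1" "u \<le> v" shows "x powr v \<le> x powr u"
  using assms by (intro powr_mono') auto

lemma trunc_powr_ge_inverse:
  assumes "0 < e" "e \<le> x" "x \<le> 1" "p \<le> 0"
  shows "1 / x \<le> trunc_powr p e x"
  using powr_le_powr_small[of x "p - 1" "-1"] assms
  by (simp add: trunc_powr_def powr_minus_divide)

lemma trunc_powr_ge_level: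
  assumes "0 < e" "e \<le> b" "x \<le> b" "b \<le> 1" "p \<le> 0"
  shows "1 / b \<le> trunc_powr p e x"
proof (cases "e \<le> x")
  case True
  have "1 / b \<le> 1 / x" using assms True by (simp add: frac_le)
  also have "\<dots> \<le> trunc_powr p e x" using trunc_powr_ge_inverse assms True by simp
  finally show ?thesis .
next
  case False
  have "1 / b \<le> 1 / e" using assms by (simp add: frac_le)
  also have "\<dots> \<le> e powr (p - 1)"
    using trunc_powr_ge_inverse[of e e p] assms by (simp add: trunc_powr_def)
  also have "\<dots> \<le> trunc_powr p e x"
    using assms False by (simp add: trunc_powr_split)
  finally show ?thesis .
qed

text \<open>Below the level \<open>b\<close> the truncated power is at least \<open>1 / b\<close>,
  and \<open>m / b \<ge> 17 * b\<close> pays for both \<open>16 * (b - x)\<close> and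
  \<open>x\<close> when \<open>x\<close> is above the cut-off; below the cut-off the affine slope
  times \<open>m\<close> is itself at least 17. So the net force beats a spring of frequency 4
  centred at \<open>b\<close>.\<close>

lemma trunc_powr_lower:
  assumes "0 < e" "e \<le> b" "x \<le> b" "b \<le> 1" "p \<le> 0" "0 < m" "17 * b^2 \<le> m"
  shows "16 * (b - x) \<le> m * trunc_powr p e x - x" (is ?A)
    and "m / 2 * trunc_powr p e x \<le> m * trunc_powr p e x - x" (is ?B)
    and "- x \<le> m * trunc_powr p e x" (is ?C)
proof -
  have b: "0 < b" using assms by simp
  have L: "m / b \<le> m * trunc_powr p e x"
    using mult_left_mono[OF trunc_powr_ge_level[OF assms(1-5)], of m] assms(6) by simp
  have mb: "17 * b \<le> m / b" using assms b by (simp add: field_simps power2_eq_square)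
  have neg: "17 * (e - x) + m / b \<le> m * trunc_powr p e x" if "x < e"
  proof -
    have "1 / b \<le> e powr (p - 1)"
      using trunc_powr_ge_level[of e b e p] assms by (simp add: trunc_powr_def)
    hence 1: "m / b \<le> m * e powr (p - 1)" using assms(6) mult_left_mono by fastforce
    have "1 / b^2 \<le> 1 / e^2" using assms by (simp add: frac_le power_mono)
    also have "\<dots> \<le> e powr (p - 2)"
      using powr_le_powr_small[of e "p - 2" "-2"] assms by (simp add: powr_minus_divide)
    finally have "m / b^2 \<le> m * e powr (p - 2)" using assms(6) mult_left_mono by fastforce
    moreover have "17 \<le> m / b^2" using assms b by (simp add: field_simps)
    ultimately have "17 * (e - x) \<le> (m * e powr (p - 2)) * (e - x)"
      using that by (intro mult_right_mono) auto
    thus ?thesis using 1 that assms(1) by (simp add: trunc_powr_split algebra_simps)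
  qed
  show ?A using L neg mb assms(1,3) b by (cases "x < e") auto
  show ?B
  proof (cases "x \<le> 0")
    case True
    have "0 < m * trunc_powr p e x" using trunc_powr_pos[OF assms(1), of p x] assms(6) by simp
    thus ?thesis using True by simp
  next
    case False thus ?thesis using L mb assms(3) b by linarith
  qed
  show ?C
  proof (cases "x < e")
    case True
    have "0 < m / b" using assms(6) b by simp
    hence "17 * (e - x) \<le> m * trunc_powr p e x" using neg[OF True] by linarith
    thus ?thesis using True assms(1) by argo
  next
    case False thus ?thesis using L mb assms b by linarith
  qed
qed

lemma trunc_powr_ge_powr: "e \<le> x \<Longrightarrow> trunc_powr p e x = x powr (p - 1)"
  by (simp add: trunc_powr_def)

text \<open>The exponent is \<open>- k - 1\<close> with \<open>k = (1 - p) / 2\<close>. It is below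
  \<open>p - 1\<close> since \<open>p > -1\<close>, and its antiderivative is a power even at
  \<open>p = 0\<close>, where that of \<open>x powr (p - 1)\<close> is a logarithm. The factor 2
  covers the affine branch.\<close>

lemma trunc_powr_le_powr:
  assumes "0 < e" "0 < x" "x \<le> 1" "-1 < p" "p \<le> 0"
  shows "trunc_powr p e x \<le> 2 * x powr ((p - 3) / 2)"
proof (cases "e \<le> x")
  case True
  have "x powr (p - 1) \<le> x powr ((p - 3) / 2)" using assms by (intro powr_le_powr_small) auto
  moreover have "0 \<le> x powr ((p - 3) / 2)" by simp
  ultimately have "x powr (p - 1) \<le> 2 * x powr ((p - 3) / 2)" by linarith
  thus ?thesis using True by (simp add: trunc_powr_def)
next
  case False
  have "trunc_powr p e x \<le> e powr (p - 2) * (2 * e)"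
    using False assms by (simp add: trunc_powr_def)
  also have "\<dots> = 2 * e powr (p - 1)"
    using assms powr_add[of e "p - 2" 1] by simp
  also have "e powr (p - 1) \<le> x powr (p - 1)"
    using False assms by (intro powr_mono2') auto
  also have "x powr (p - 1) \<le> x powr ((p - 3) / 2)" using assms by (intro powr_le_powr_small) auto
  finally show ?thesis by simp
qed

lemma trunc_powr_antimono:
  assumes "0 < e" "p \<le> 1" "x \<le> y"
  shows "trunc_powr p e y \<le> trunc_powr p e x"
proof (cases "e \<le> x")
  case True thus ?thesis using assms by (auto simp: trunc_powr_def intro: powr_mono2')
next
  case False
  show ?thesis
  proof (cases "e \<le> y")
    case True
    have "y powr (p - 1) \<le> e powr (p - 1)" using assms True by (intro powr_mono2') auto
    moreover have "0 \<le> e powr (p - 2) * (e - x)" using False by simp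
    ultimately have "y powr (p - 1) \<le> e powr (p - 1) + e powr (p - 2) * (e - x)" by linarith
    thus ?thesis using True False assms
      by (simp add: trunc_powr_split trunc_powr_ge_powr)
  next
    case F: False
    thus ?thesis using False assms by (simp add: trunc_powr_def)
  qed
qed

text \<open>Above the cut-off the mean value theorem applies, with the steepest slope at
  \<open>e\<close>; the affine slope fits the same constant because \<open>1 - p \<ge> 1\<close>.
  Intervals around \<open>e\<close> are split there.\<close>

lemma trunc_powr_lipschitz:
  assumes "0 < e" "p \<le> 0"
  shows "\<bar>trunc_powr p e x - trunc_powr p e y\<bar> \<le> (1 - p) * e powr (p - 2) * \<bar>x - y\<bar>"
proof -
  let ?L = "(1 - p) * e powr (p - 2)"
  have L0: "0 \<le> ?L" using assms by simp
  have up: "\<bar>trunc_powr p e u - trunc_powr p e v\<bar> \<le> ?L * (v - u)" if eu: "e \<le> u" and "u \<le> v" for u v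
  proof (cases "u = v")
    case False
    have d: "((\<lambda>x. x powr (p - 1)) has_real_derivative (p - 1) * x powr (p - 2)) (at x)" if "u \<le> x" for x
      using has_real_derivative_powr[of x "p - 1"] that \<open>e \<le> u\<close> assms by simp
    from that False have "u < v" by simp
    obtain z where z: "u < z" "z < v" "v powr (p - 1) - u powr (p - 1) = (v - u) * ((p - 1) * z powr (p - 2))"
      using MVT2[of u v "\<lambda>x. x powr (p - 1)" "\<lambda>x. (p - 1) * x powr (p - 2)"] d \<open>u < v\<close> by auto
    have "z powr (p - 2) \<le> e powr (p - 2)" using z that assms by (intro powr_mono2') auto
    hence "(1 - p) * z powr (p - 2) \<le> ?L" using assms by (intro mult_left_mono) auto
    hence "(v - u) * ((1 - p) * z powr (p - 2)) \<le> (v - u) * ?L" using that by (intro mult_left_mono[of _ ?L]) auto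
    moreover have "0 \<le> (v - u) * ((1 - p) * z powr (p - 2))" using that assms by simp
    ultimately show ?thesis using z that by (simp add: trunc_powr_ge_powr algebra_simps)
  qed simp
  have dn: "\<bar>trunc_powr p e u - trunc_powr p e v\<bar> \<le> ?L * (v - u)" if "v \<le> e" "u \<le> v" for u v
  proof -
    have *: "trunc_powr p e u = e powr (p - 1) + e powr (p - 2) * (e - u)" if "u \<le> e" for u
      using trunc_powr_split[of e u p] that assms by (cases "u = e") (auto simp: trunc_powr_ge_powr)
    have "trunc_powr p e u - trunc_powr p e v = e powr (p - 2) * (v - u)"
      using *[of u] *[of v] that by (simp add: algebra_simps)
    moreover have "e powr (p - 2) * (v - u) \<le> ?L * (v - u)"
      using that assms by (intro mult_right_mono) (auto simp: algebra_simps mult_nonpos_nonneg)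
    ultimately show ?thesis using that by simp
  qed
  have main: "\<bar>trunc_powr p e u - trunc_powr p e v\<bar> \<le> ?L * (v - u)" if "u \<le> v" for u v
  proof -
    consider "e \<le> u" | "v \<le> e" | "u < e" "e < v" by linarith
    thus ?thesis
    proof cases
      case 3
      have "\<bar>trunc_powr p e u - trunc_powr p e v\<bar> \<le> ?L * (e - u) + ?L * (v - e)"
        using dn[of e u] up[of e v] 3 by simp
      thus ?thesis by (simp add: algebra_simps)
    qed (use up dn that in auto)
  qed
  show ?thesis using main[of x y] main[of y x] by (cases "x \<le> y") (auto simp: abs_minus_commute)
qed

lemma continuous_antiderivative:
  fixes f :: "real \<Rightarrow> 'a::euclidean_space"
  assumes "continuous_on UNIV f"
  shows "\<exists>H. \<forall>t. (H has_vector_derivative f t) (at t)"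
  using einterval_antiderivative[of "-\<infinity>" "\<infinity>" f] assms
  by (auto simp: continuous_on_eq_continuous_at)

section \<open>Bumps between deep valleys\<close>

lemma DERIV_le_linear:
  fixes f :: "real \<Rightarrow> real"
  assumes "a \<le> b" "\<And>x. a \<le> x \<Longrightarrow> x \<le> b \<Longrightarrow> (f has_real_derivative f' x) (at x)"
    and "\<And>x. a \<le> x \<Longrightarrow> x \<le> b \<Longrightarrow> f' x \<le> B"
  shows "f b \<le> f a + B * (b - a)"
proof -
  have "(\<lambda>x. B * x - f x) a \<le> (\<lambda>x. B * x - f x) b"
  proof (rule DERIV_nonneg_imp_nondecreasing[OF assms(1)])
    fix x assume x: "a \<le> x" "x \<le> b"
    have "((\<lambda>x. B * x - f x) has_real_derivative B - f' x) (at x)"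
      using assms(2)[OF x] by (auto intro!: derivative_eq_intros)
    thus "\<exists>y. ((\<lambda>x. B * x - f x) has_real_derivative y) (at x) \<and> 0 \<le> y"
      using assms(3)[OF x] by (intro exI[of _ "B - f' x"]) simp
  qed
  thus ?thesis by (simp add: algebra_simps)
qed

lemma DERIV_ge_linear:
  fixes f :: "real \<Rightarrow> real"
  assumes "a \<le> b" "\<And>x. a \<le> x \<Longrightarrow> x \<le> b \<Longrightarrow> (f has_real_derivative f' x) (at x)"
    and "\<And>x. a \<le> x \<Longrightarrow> x \<le> b \<Longrightarrow> B \<le> f' x"
  shows "f a + B * (b - a) \<le> f b"
proof -
  have "- f b \<le> - f a + - B * (b - a)"
    by (rule DERIV_le_linear[OF assms(1), of _ "\<lambda>x. - f' x"]) (use assms in \<open>auto intro: DERIV_minus\<close>)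
  thus ?thesis by simp
qed

text \<open>Compactness gives a least point of the superlevel set in \<open>{a..b}\<close>; the
  intermediate value theorem forces the value there to be exactly \<open>c\<close>.\<close>

lemma first_root:
  fixes f :: "real \<Rightarrow> real"
  assumes "a \<le> b" "continuous_on {a..b} f" "f a \<le> c" "c \<le> f b"
  obtains d where "a \<le> d" "d \<le> b" "f d = c" "\<And>t. a \<le> t \<Longrightarrow> t < d \<Longrightarrow> f t < c"
proof -
  let ?S = "{a..b} \<inter> f -` {c..}"
  have "closed ?S" using assms(2) by (intro continuous_closed_preimage) auto
  hence "compact ?S" by (metis compact_Icc compact_Int_closed inf_left_idem)
  moreover have "b \<in> ?S" using assms by auto
  ultimately obtain d where d: "d \<in> ?S" "\<And>t. t \<in> ?S \<Longrightarrow> d \<le> t"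
    using compact_attains_inf[of ?S] by blast
  have lt: "f t < c" if "a \<le> t" "t < d" for t
    using d(2)[of t] d(1) that by fastforce
  obtain x where x: "a \<le> x" "x \<le> d" "f x = c"
    using IVT'[of f a c d] assms d continuous_on_subset[OF assms(2), of "{a..d}"] by auto
  have "x = d" using lt[of x] x by fastforce
  thus ?thesis using that[of d] x d lt by auto
qed

lemma cos_le_minus_half:
  fixes t :: real assumes "2 * pi / 3 \<le> t" "t \<le> 4 * pi / 3" shows "cos t \<le> - (1 / 2)"
proof -
  have "cos (pi / 3) \<le> cos \<bar>t - pi\<bar>"
    using assms pi_ge_two by (intro cos_monotone_0_pi_le) (auto simp: abs_if)
  also have "cos \<bar>t - pi\<bar> = - cos t" by (simp add: cos_diff)
  finally show ?thesis by (simp add: cos_60)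
qed

lemma sin_ge_half:
  fixes t :: real assumes "pi / 6 \<le> t" "t \<le> 5 * pi / 6" shows "1 / 2 \<le> sin t"
proof -
  have "cos (pi / 3) \<le> cos \<bar>pi / 2 - t\<bar>"
    using assms pi_ge_two by (intro cos_monotone_0_pi_le) (auto simp: abs_if)
  also have "cos \<bar>pi / 2 - t\<bar> = sin t" by (simp add: cos_diff)
  finally show ?thesis by (simp add: cos_60)
qed

text \<open>With \<open>k = (1 - p) / 2\<close>, a valley of depth \<open>u\<close> and potential \<open>A\<close> is left with
  a speed \<open>y\<close> of order at most \<open>u powr (- k / 2)\<close>. As \<open>k\<^sup>2 < 1\<close>, which is
  exactly \<open>p > -1\<close>, the depth \<open>u\<close> is negligible against \<open>y powr (p - 1)\<close>.\<close>

lemma small_threshold: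
  fixes c C k :: real
  assumes "0 < c" "0 < C" "0 < k" "k < 1"
  obtains X where "\<And>u A y. \<lbrakk>0 < u; X \<le> A; A \<le> 2 / k * u powr (- k); 0 < y; y\<^sup>2 \<le> C * A\<rbrakk>
      \<Longrightarrow> u < c * y powr (- 2 * k)"
proof -
  define D where "D = 2 * C / k"
  \<comment> \<open>\<open>u0\<close> solves
    \<open>u powr (1 - k\<^sup>2) = c * D powr (- k)\<close>; smaller \<open>u\<close> satisfy the
    claim once \<open>y\<^sup>2 \<le> D * u powr (- k)\<close>.\<close>
  define u0 where "u0 = (c * D powr (- k)) powr (1 / (1 - k\<^sup>2))"
  have D: "0 < D" using assms by (simp add: D_def)
  have k2: "0 < 1 - k\<^sup>2" using assms by (simp add: power_less_one_iff abs_square_less_1)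
  have u0: "0 < u0" using assms D by (simp add: u0_def)
  show ?thesis
  \<comment> \<open>Potentials of at least this size are out of reach for depths
    \<open>u \<ge> u0\<close>.\<close>
  proof (rule that[of "2 / k * u0 powr (- k) + 1"])
    fix u A y :: real
    assume u: "0 < u" and X: "2 / k * u0 powr (- k) + 1 \<le> A"
      and A: "A \<le> 2 / k * u powr (- k)" and y: "0 < y" "y\<^sup>2 \<le> C * A"
    have "u < u0"
    proof (rule ccontr)
      assume "\<not> u < u0"
      hence "u powr (- k) \<le> u0 powr (- k)" using u0 assms by (intro powr_mono2') auto
      hence "2 / k * u powr (- k) \<le> 2 / k * u0 powr (- k)"
        using assms by (intro mult_left_mono) auto
      thus False using X A by linarith
    qed
    hence "u powr (1 - k\<^sup>2) < u0 powr (1 - k\<^sup>2)" using u k2 by (intro powr_less_mono2) auto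
    also have "\<dots> = c * D powr (- k)"
      using k2 assms D by (simp add: u0_def powr_powr)
    finally have 1: "u powr (1 - k\<^sup>2) < c * D powr (- k)" .
    have "y\<^sup>2 \<le> C * (2 / k * u powr (- k))"
      using y(2) mult_left_mono[OF A, of C] assms by linarith
    also have "\<dots> = D * u powr (- k)" by (simp add: D_def)
    finally have "y\<^sup>2 \<le> D * u powr (- k)" .
    hence "(D * u powr (- k)) powr (- k) \<le> (y\<^sup>2) powr (- k)"
      using y assms by (intro powr_mono2') auto
    also have "(y\<^sup>2) powr (- k) = y powr (- 2 * k)"
      using y by (simp add: powr_powr flip: powr_numeral)
    also have "(D * u powr (- k)) powr (- k) = D powr (- k) * u powr (k\<^sup>2)"
      using D u by (simp add: powr_mult powr_powr power2_eq_square)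
    finally have 2: "D powr (- k) * u powr (k\<^sup>2) \<le> y powr (- 2 * k)" .
    have "u = u powr (1 - k\<^sup>2) * u powr (k\<^sup>2)"
      using u powr_add[of u "1 - k\<^sup>2" "k\<^sup>2"] by simp
    also have "\<dots> < c * D powr (- k) * u powr (k\<^sup>2)" using 1 u by (intro mult_strict_right_mono) auto
    also have "\<dots> \<le> c * y powr (- 2 * k)" using 2 assms by (simp add: mult.assoc)
    finally show "u < c * y powr (- 2 * k)" .
  qed
qed

text \<open>\<open>F\<close> is any forcing between \<open>m\<close> and \<open>M\<close> times the
  truncated power, so the estimates are uniform over all coefficients with these bounds.
  \<open>b\<close> marks the valleys: below it the force dominates \<open>h\<close> and acts within
  time \<open>pi / 8\<close>.\<close>

locale oscillator =
  fixes p m M b e :: real and h h1 F G :: "real \<Rightarrow> real"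
  assumes p: "-1 < p" "p \<le> 0" and m: "0 < m" "m \<le> M"
    and b: "b \<le> 1" "17 * b\<^sup>2 \<le> m" and e: "0 < e" "e \<le> b"
    and dh: "\<And>t. (h has_real_derivative h1 t) (at t)"
    and dh1: "\<And>t. (h1 has_real_derivative F t - h t) (at t)"
    and F_ge: "\<And>t. m * trunc_powr p e (h t) \<le> F t"
    and F_le: "\<And>t. F t \<le> M * trunc_powr p e (h t)"
    and dG: "\<And>x. (G has_real_derivative trunc_powr p e x) (at x)"
begin

abbreviation "g \<equiv> trunc_powr p e"

text \<open>Potential drop from the level \<open>b\<close> to \<open>x\<close>; large values stand
  for deep valleys.\<close>

definition "gam x = G b - G x"

definition "B = M * b powr (p - 1)"

section \<open>Force bounds and comparison with rotations\<close>

lemma b_pos: "0 < b" using e by simp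

lemma B_nonneg: "0 \<le> B" using m by (simp add: B_def)

lemma F_pos: "0 < F t"
  using F_ge[of t] trunc_powr_pos[OF e(1), of p "h t"] m(1)
  by (meson less_le_trans mult_pos_pos)

lemma F_le_B: "b \<le> h t \<Longrightarrow> F t \<le> B"
proof -
  assume h: "b \<le> h t"
  have "h t powr (p - 1) \<le> b powr (p - 1)" using h b_pos p by (intro powr_mono2') auto
  hence "M * g (h t) \<le> B" using h e m by (simp add: B_def trunc_powr_ge_powr)
  thus ?thesis using F_le[of t] by linarith
qed

lemma force_ge: "h t \<le> b \<Longrightarrow> 16 * (b - h t) \<le> F t - h t"
  using trunc_powr_lower(1)[of e b "h t" p m] F_ge[of t] p m b e by simp

lemma force_ge': "h t \<le> b \<Longrightarrow> m / 2 * g (h t) \<le> F t - h t"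
  using trunc_powr_lower(2)[of e b "h t" p m] F_ge[of t] p m b e by simp

lemma force_le: "h t \<le> b \<Longrightarrow> F t - h t \<le> (M + m) * g (h t)"
  using trunc_powr_lower(3)[of e b "h t" p m] F_le[of t] p m b e by (simp add: algebra_simps)

lemma h_cont: "continuous_on S h"
  using dh by (meson DERIV_isCont continuous_at_imp_continuous_on)

lemma h1_cont: "continuous_on S h1"
  using dh1 by (meson DERIV_isCont continuous_at_imp_continuous_on)

text \<open>Variation of constants: \<open>h\<close> and \<open>h1\<close> are compared with the rotation solving
  \<open>h'' + h = 0\<close>.\<close>

lemma rotate_h: "((\<lambda>s. h s * cos (t - s) + h1 s * sin (t - s)) has_real_derivative F s * sin (t - s)) (at s)"
  by (auto intro!: derivative_eq_intros dh dh1 simp: algebra_simps)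

lemma rotate_h1: "((\<lambda>s. h1 s * cos (t - s) - h s * sin (t - s)) has_real_derivative F s * cos (t - s)) (at s)"
  by (auto intro!: derivative_eq_intros dh dh1 simp: algebra_simps)

text \<open>Up to time \<open>pi\<close> the factor \<open>sin (t - s)\<close> is nonnegative, so
  the positive forcing only lifts \<open>h\<close> above the free rotation.\<close>

lemma h_lower:
  assumes "d \<le> t" "t \<le> d + pi"
  shows "h d * cos (t - d) + h1 d * sin (t - d) \<le> h t"
proof -
  have "0 \<le> F s * sin (t - s)" if "d \<le> s" "s \<le> t" for s
    using F_pos[of s] sin_ge_zero[of "t - s"] that assms by simp
  thus ?thesis using DERIV_ge_linear[OF assms(1) rotate_h, of 0 t] by simp
qed

lemma F_mult_le:
  assumes "b \<le> h t" "\<bar>x\<bar> \<le> 1" shows "F t * x \<le> B"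
proof -
  have "F t * x \<le> F t * 1" using F_pos[of t] assms by (intro mult_left_mono) auto
  thus ?thesis using F_le_B[OF assms(1)] by simp
qed

lemma h_upper:
  assumes "d \<le> t" "\<And>s. d \<le> s \<Longrightarrow> s \<le> t \<Longrightarrow> b \<le> h s"
  shows "h t \<le> h d * cos (t - d) + h1 d * sin (t - d) + B * (t - d)"
  using DERIV_le_linear[OF assms(1) rotate_h, of t B] assms(2) F_mult_le by auto

lemma h1_upper:
  assumes "d \<le> t" "\<And>s. d \<le> s \<Longrightarrow> s \<le> t \<Longrightarrow> b \<le> h s"
  shows "h1 t \<le> h1 d * cos (t - d) - h d * sin (t - d) + B * (t - d)"
  using DERIV_le_linear[OF assms(1) rotate_h1, of t B] assms(2) F_mult_le by auto

text \<open>Sturm comparison: below \<open>b\<close> the restoring force is at least that of a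
  spring of frequency 4, whose quarter period is \<open>pi / 8\<close>. Until the exit
  \<open>h1\<close> increases, hence is positive.\<close>

lemma valley_exit:
  assumes "h1 a = 0" "h a < b"
  obtains d where "a < d" "d \<le> a + pi / 8" "h d = b"
    "\<And>t. a \<le> t \<Longrightarrow> t < d \<Longrightarrow> h t < b" "\<And>t. a < t \<Longrightarrow> t \<le> d \<Longrightarrow> 0 < h1 t"
proof -
  have "\<exists>t. a \<le> t \<and> t \<le> a + pi / 8 \<and> b \<le> h t"
  proof (rule ccontr)
    assume "\<not> ?thesis"
    hence lt: "h t < b" if "a \<le> t" "t \<le> a + pi / 8" for t using that by force
    \<comment> \<open>Wronskian of \<open>b - h\<close> and \<open>cos (4 * (t - a))\<close>\<close>
    define Q where "Q = (\<lambda>t. 4 * (b - h t) * sin (4 * (t - a)) - h1 t * cos (4 * (t - a)))"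
    have dQ: "(Q has_real_derivative (16 * (b - h t) - (F t - h t)) * cos (4 * (t - a))) (at t)" for t
      unfolding Q_def by (auto intro!: derivative_eq_intros dh dh1 simp: algebra_simps)
    have "Q (a + pi / 8) \<le> Q a + 0 * (a + pi / 8 - a)"
    proof (rule DERIV_le_linear[OF _ dQ])
      fix t assume t: "a \<le> t" "t \<le> a + pi / 8"
      have "0 \<le> cos (4 * (t - a))" using t pi_ge_two by (intro cos_ge_zero) (auto simp: field_simps)
      thus "(16 * (b - h t) - (F t - h t)) * cos (4 * (t - a)) \<le> 0"
        using force_ge[of t] lt[OF t] by (intro mult_nonpos_nonneg) auto
    qed simp
    moreover have "Q a = 0" using assms by (simp add: Q_def)
    moreover have "Q (a + pi / 8) = 4 * (b - h (a + pi / 8))" by (simp add: Q_def)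
    ultimately show False using lt[of "a + pi / 8"] by simp
  qed
  then obtain t0 where t0: "a \<le> t0" "t0 \<le> a + pi / 8" "b \<le> h t0" by auto
  obtain d where d: "a \<le> d" "d \<le> t0" "h d = b" "\<And>t. a \<le> t \<Longrightarrow> t < d \<Longrightarrow> h t < b"
    using first_root[OF t0(1) h_cont, of b] t0 assms by auto
  have ad: "a < d" using d(1,3) assms by (cases "a = d") auto
  have "0 < h1 t" if "a < t" "t \<le> d" for t
  proof -
    have "h1 a < h1 t"
    proof (rule DERIV_pos_imp_increasing_open[OF that(1) _ h1_cont])
      fix x assume "a < x" "x < t"
      hence "h x < b" using d(4)[of x] that by simp
      thus "\<exists>y. (h1 has_real_derivative y) (at x) \<and> 0 < y"
        using force_ge[of x] dh1[of x] by (intro exI[of _ "F x - h x"]) auto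
    qed
    thus ?thesis using assms by simp
  qed
  thus ?thesis using that[of d] ad d t0 by auto
qed

text \<open>The same comparison, started at the level \<open>b\<close> with downward speed: a spring
  of frequency 4 would halt the motion after a quarter period.\<close>

lemma valley_entry:
  assumes "h d = b" "h1 d < 0"
  obtains a where "d < a" "a \<le> d + pi / 8" "h1 a = 0"
    "\<And>t. d \<le> t \<Longrightarrow> t < a \<Longrightarrow> h1 t < 0" "\<And>t. d < t \<Longrightarrow> t \<le> a \<Longrightarrow> h t < b"
proof -
  have desc: "h t < b" if "d < t" "\<And>s. d \<le> s \<Longrightarrow> s < t \<Longrightarrow> h1 s < 0" for t
  proof -
    have "h t < h d"
      by (rule DERIV_neg_imp_decreasing_open[OF that(1) _ h_cont]) (use dh that(2) in force)
    thus ?thesis using assms by simp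
  qed
  have "\<exists>t. d \<le> t \<and> t \<le> d + pi / 8 \<and> 0 \<le> h1 t"
  proof (rule ccontr)
    assume "\<not> ?thesis"
    hence lt: "h1 t < 0" if "d \<le> t" "t \<le> d + pi / 8" for t using that by force
    have hb: "h t \<le> b" if "d \<le> t" "t \<le> d + pi / 8" for t
      using desc[of t] lt that assms by (cases "t = d") fastforce+
    \<comment> \<open>Wronskian of \<open>b - h\<close> and \<open>sin (4 * (t - d))\<close>\<close>
    define Q where "Q = (\<lambda>t. - h1 t * sin (4 * (t - d)) - 4 * (b - h t) * cos (4 * (t - d)))"
    have dQ: "(Q has_real_derivative (16 * (b - h t) - (F t - h t)) * sin (4 * (t - d))) (at t)" for t
      unfolding Q_def by (auto intro!: derivative_eq_intros dh dh1 simp: algebra_simps)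
    have "Q (d + pi / 8) \<le> Q d + 0 * (d + pi / 8 - d)"
    proof (rule DERIV_le_linear[OF _ dQ])
      fix t assume t: "d \<le> t" "t \<le> d + pi / 8"
      have "0 \<le> sin (4 * (t - d))" using t pi_ge_two by (intro sin_ge_zero) (auto simp: field_simps)
      thus "(16 * (b - h t) - (F t - h t)) * sin (4 * (t - d)) \<le> 0"
        using force_ge[of t] hb[OF t] by (intro mult_nonpos_nonneg) auto
    qed simp
    moreover have "Q d = 0" using assms by (simp add: Q_def)
    moreover have "Q (d + pi / 8) = - h1 (d + pi / 8)" by (simp add: Q_def)
    ultimately show False using lt[of "d + pi / 8"] by simp
  qed
  then obtain t0 where t0: "d \<le> t0" "t0 \<le> d + pi / 8" "0 \<le> h1 t0" by auto
  obtain a where a: "d \<le> a" "a \<le> t0" "h1 a = 0" "\<And>t. d \<le> t \<Longrightarrow> t < a \<Longrightarrow> h1 t < 0"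
    using first_root[OF t0(1) h1_cont, of 0] t0 assms by auto
  have "d < a" using a(1,3) assms by (cases "a = d") auto
  moreover have "h t < b" if "d < t" "t \<le> a" for t using desc[of t] that a(4) by auto
  ultimately show ?thesis using that[of a] a t0 by auto
qed

section \<open>Exchange of kinetic and potential energy in a valley\<close>

lemma energy_ge:
  assumes "u \<le> v" "\<And>t. u \<le> t \<Longrightarrow> t \<le> v \<Longrightarrow> h t \<le> b \<and> 0 \<le> h1 t"
  shows "(h1 u)\<^sup>2 - m * G (h u) \<le> (h1 v)\<^sup>2 - m * G (h v)"
proof -
  have d: "((\<lambda>t. (h1 t)\<^sup>2 - m * G (h t)) has_real_derivative 2 * h1 t * ((F t - h t) - m / 2 * g (h t))) (at t)" for t
    by (auto intro!: derivative_eq_intros dh1 DERIV_chain2[OF dG dh] simp: algebra_simps)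
  show ?thesis
    using DERIV_ge_linear[OF assms(1) d, of 0] assms(2) force_ge' by auto
qed

lemma energy_le_rise:
  assumes "u \<le> v" "\<And>t. u \<le> t \<Longrightarrow> t \<le> v \<Longrightarrow> h t \<le> b \<and> 0 \<le> h1 t"
  shows "(h1 v)\<^sup>2 - 2 * (M + m) * G (h v) \<le> (h1 u)\<^sup>2 - 2 * (M + m) * G (h u)"
proof -
  have d: "((\<lambda>t. (h1 t)\<^sup>2 - 2 * (M + m) * G (h t)) has_real_derivative 2 * h1 t * ((F t - h t) - (M + m) * g (h t))) (at t)" for t
    by (auto intro!: derivative_eq_intros dh1 DERIV_chain2[OF dG dh] simp: algebra_simps)
  show ?thesis
    using DERIV_le_linear[OF assms(1) d, of 0] assms(2) force_le by (auto simp: mult_nonneg_nonpos)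
qed

text \<open>The upper force bound is multiplied by \<open>2 * h1\<close>, which is nonpositive on
  the descent, so the inequality turns round compared with the ascent. It bounds the entry speed by
  the depth reached.\<close>

lemma energy_le_fall:
  assumes "u \<le> v" "\<And>t. u \<le> t \<Longrightarrow> t \<le> v \<Longrightarrow> h t \<le> b \<and> h1 t \<le> 0"
  shows "(h1 u)\<^sup>2 - 2 * (M + m) * G (h u) \<le> (h1 v)\<^sup>2 - 2 * (M + m) * G (h v)"
proof -
  have d: "((\<lambda>t. (h1 t)\<^sup>2 - 2 * (M + m) * G (h t)) has_real_derivative 2 * h1 t * ((F t - h t) - (M + m) * g (h t))) (at t)" for t
    by (auto intro!: derivative_eq_intros dh1 DERIV_chain2[OF dG dh] simp: algebra_simps)
  show ?thesis
    using DERIV_ge_linear[OF assms(1) d, of 0] assms(2) force_le by (auto simp: mult_nonpos_nonpos)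
qed

text \<open>\<open>trunc_powr_le_powr\<close> is integrated from \<open>x\<close> to
  \<open>b\<close>; the boundary term at \<open>b\<close> has a favourable sign and is
  dropped.\<close>

lemma gam_le:
  assumes "0 < x" "x \<le> b"
  shows "gam x \<le> 2 / ((1 - p) / 2) * x powr (- ((1 - p) / 2))"
proof -
  define k where "k = (1 - p) / 2"
  have k: "0 < k" using p by (simp add: k_def)
  have "- 2 / k * x powr (- k) - G x + 0 * (b - x) \<le> - 2 / k * b powr (- k) - G b"
  proof (rule DERIV_ge_linear[OF assms(2), of _ "\<lambda>x. 2 * x powr ((p - 3) / 2) - g x"])
    fix t assume t: "x \<le> t" "t \<le> b"
    have "(p - 3) / 2 = - k - 1" by (simp add: k_def field_simps)
    hence "((\<lambda>x. x powr (- k)) has_real_derivative - k * t powr ((p - 3) / 2)) (at t)"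
      using has_real_derivative_powr[of t "- k"] t assms by (simp only:)
    from DERIV_diff[OF DERIV_cmult[OF this, of "- 2 / k"] dG[of t]] 
    show "((\<lambda>x. - 2 / k * x powr (- k) - G x) has_real_derivative 2 * t powr ((p - 3) / 2) - g t) (at t)"
      using k by simp
    show "0 \<le> 2 * t powr ((p - 3) / 2) - g t"
      using trunc_powr_le_powr[of e t p] e t assms b p by simp
  qed
  moreover have "0 \<le> 2 / k * b powr (- k)" using k by simp
  ultimately show ?thesis unfolding gam_def k_def[symmetric] by simp
qed


text \<open>One full arch from a deep valley at \<open>a\<close> to the next at \<open>a'\<close>,
  losing at most the factor \<open>32 * (M + m) / m\<close> of potential. \<open>X\<close> makes the
  exit speed large against \<open>B\<close>, and \<open>small\<close> is the conclusion of
  \<open>small_threshold\<close> for \<open>k = (1 - p) / 2\<close>.\<close>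

lemma bump:
  assumes X: "400 * (B + 1)\<^sup>2 \<le> m * X"
    and small: "\<And>u A y. \<lbrakk>0 < u; X \<le> A; A \<le> 2 / ((1 - p) / 2) * u powr (- ((1 - p) / 2)); 0 < y;
        y\<^sup>2 \<le> 32 * (M + m) * A\<rbrakk> \<Longrightarrow> u < m / 24 * y powr (p - 1)"
    and a: "h1 a = 0" "h a < b" and gam: "32 * (M + m) * X \<le> m * gam (h a)"
  obtains a' where "a + pi < a'" "a' < a + 2 * pi" "h1 a' = 0" "h a' < b"
    "m * gam (h a) \<le> 32 * (M + m) * gam (h a')"
    "\<And>t. \<lbrakk>a < t; t < a'; h1 t = 0\<rbrakk> \<Longrightarrow> b \<le> h t"
proof -
  obtain d where d: "a < d" "d \<le> a + pi / 8" "h d = b"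
    "\<And>t. a \<le> t \<Longrightarrow> t < d \<Longrightarrow> h t < b" "\<And>t. a < t \<Longrightarrow> t \<le> d \<Longrightarrow> 0 < h1 t"
    using valley_exit[OF a] by blast
  define y where "y = h1 d"
  have y0: "0 < y" using d by (simp add: y_def)
  have val: "h t \<le> b \<and> 0 \<le> h1 t" if "a \<le> t" "t \<le> d" for t
    using d(3) d(4)[of t] d(5)[of t] that a by (cases "t = d"; cases "t = a") (auto simp: less_imp_le)
  have y_low: "m * gam (h a) \<le> y\<^sup>2"
    using energy_ge[of a d] val d(1,3) a by (simp add: gam_def y_def algebra_simps)
  have y_up: "y\<^sup>2 \<le> 2 * (M + m) * gam (h a)"
    using energy_le_rise[of a d] val d(1,3) a by (simp add: gam_def y_def algebra_simps)
  have "0 \<le> m * X" using X by (smt (verit) zero_le_power2)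
  hence X0: "0 \<le> X" using m(1) by (simp add: zero_le_mult_iff)
  have "m * X \<le> 32 * (M + m) * X" using X0 m by (intro mult_right_mono) auto
  hence "m * X \<le> m * gam (h a)" using gam by linarith
  hence gX: "X \<le> gam (h a)" using m(1) by simp
  \<comment> \<open>The 400 in the hypothesis on \<open>X\<close> is 20 squared; at this speed all
    terms in \<open>B\<close> and \<open>b\<close> along the arch are small against
    \<open>y\<close>.\<close>
  have "(20 * (B + 1))\<^sup>2 \<le> y\<^sup>2"
    using X \<open>m * X \<le> m * gam (h a)\<close> y_low unfolding power_mult_distrib by simp
  hence y20: "20 * (B + 1) \<le> y" using y0 by (simp add: power2_le_iff_abs_le abs_le_iff power_mono_iff B_nonneg)
  have piB: "B * x \<le> B * (4 * pi / 3)" "B * (4 * pi / 3) \<le> 5 * B" if "x \<le> 4 * pi / 3" for x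
    using B_nonneg that pi_less_4 mult_left_mono[of "4 * pi / 3" 5 B] 
      pi_approx mult_left_mono[of x "4 * pi / 3" B] by auto
  \<comment> \<open>The half-angle \<open>s\<close> factors
    \<open>b * cos (2 * s) + y * sin (2 * s) - b\<close> as
    \<open>2 * sin s * (y * cos s - b * sin s)\<close>, positive because
    \<open>cos s \<ge> 1 / 2\<close> and \<open>y\<close> is large.\<close>
  have above: "b < h t" if "d < t" "t \<le> d + 2 * pi / 3" for t
  proof -
    define s where "s = (t - d) / 2"
    have s: "0 < s" "s \<le> pi / 3" using that by (auto simp: s_def)
    have "cos (pi / 3) \<le> cos s" using s pi_ge_two by (intro cos_monotone_0_pi_le) auto
    hence c: "1 / 2 \<le> cos s" by (simp add: cos_60)
    have sn: "0 < sin s" using s pi_ge_two by (intro sin_gt_zero) auto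
    have "b * sin s \<le> 1" using b b_pos sn by (intro mult_le_one) auto
    also have "\<dots> < y * (1 / 2)" using y20 B_nonneg by simp
    also have "\<dots> \<le> y * cos s" using c y0 by (intro mult_left_mono) auto
    finally have "0 < 2 * sin s * (y * cos s - b * sin s)" using sn by simp
    also have "\<dots> = b * cos (2 * s) + y * sin (2 * s) - b"
      unfolding cos_double_sin sin_double by (simp add: algebra_simps power2_eq_square)
    also have "2 * s = t - d" by (simp add: s_def)
    finally have "b < b * cos (t - d) + y * sin (t - d)" by simp
    also have "\<dots> \<le> h t" using h_lower[of d t] that d(3) pi_ge_two by (simp add: y_def)
    finally show ?thesis .
  qed
  have trig: "b * x \<le> 1" if "x \<le> 1" for x
  proof -
    have "b * x \<le> b * 1" using that b_pos by (intro mult_left_mono) auto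
    thus ?thesis using b by simp
  qed
  \<comment> \<open>Otherwise the upper bound at \<open>d + 4 * pi / 3\<close>, where the sine is at
    most \<open>- (1 / 2)\<close>, would make \<open>h\<close> negative.\<close>
  have "\<exists>t. d + 2 * pi / 3 \<le> t \<and> t \<le> d + 4 * pi / 3 \<and> h t \<le> b"
  proof (rule ccontr)
    assume neg: "\<not> ?thesis"
    have all: "b \<le> h s" if "d \<le> s" "s \<le> d + 4 * pi / 3" for s
      using neg above[of s] that d(3) by (cases "s = d"; cases "s \<le> d + 2 * pi / 3") (auto simp: less_imp_le)
    have "sin (4 * pi / 3) = - sin (pi / 3)"
      using sin_periodic_pi[of "pi / 3"] by (simp add: field_simps)
    hence "sin (4 * pi / 3) \<le> - (1 / 2)" using sin_ge_half[of "pi / 3"] by simp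
    hence "y * sin (4 * pi / 3) \<le> y * - (1 / 2)" using y0 by (intro mult_left_mono) auto
    moreover have "h (d + 4 * pi / 3) \<le> b * cos (4 * pi / 3) + y * sin (4 * pi / 3) + B * (4 * pi / 3)"
      using h_upper[of d "d + 4 * pi / 3"] all d(3) by (simp add: y_def)
    ultimately have "h (d + 4 * pi / 3) \<le> 1 - y / 2 + 5 * B"
      using trig[of "cos (4 * pi / 3)"] piB[of 0] by simp
    thus False using all[of "d + 4 * pi / 3"] y20 B_nonneg b_pos by simp
  qed
  then obtain t0 where t0: "d + 2 * pi / 3 \<le> t0" "t0 \<le> d + 4 * pi / 3" "h t0 \<le> b" by auto
  \<comment> \<open>First return to the level \<open>b\<close>; the search starts at
    \<open>d + 2 * pi / 3\<close> because \<open>h d = b\<close> already holds at the exit.\<close>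
  have "continuous_on {d + 2 * pi / 3..t0} (\<lambda>t. - h t)" by (intro continuous_intros h_cont)
  then obtain d' where d': "d + 2 * pi / 3 \<le> d'" "d' \<le> t0" "h d' = b"
      "\<And>t. d + 2 * pi / 3 \<le> t \<Longrightarrow> t < d' \<Longrightarrow> b < h t"
    using first_root[OF t0(1), of "\<lambda>t. - h t" "- b"] t0 above[of "d + 2 * pi / 3"] by auto
  have bulk: "b \<le> h t" if "d \<le> t" "t \<le> d'" for t
    using that above[of t] d'(3) d'(4)[of t] d(3)
    by (cases "t = d"; cases "t = d'"; cases "t \<le> d + 2 * pi / 3") (auto simp: less_imp_le)
  have bulk': "b < h t" if "d < t" "t < d'" for t
    using that above[of t] d'(4)[of t] by (cases "t \<le> d + 2 * pi / 3") auto
  have dd': "2 * pi / 3 \<le> d' - d" "d' - d \<le> 4 * pi / 3" using d' t0 by auto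
  have dd: "d \<le> d'" using d'(1) pi_ge_two by auto
  \<comment> \<open>The cosine is at most \<open>- (1 / 2)\<close> on the whole return window, so at
    least a quarter of the exit speed survives.\<close>
  have slope: "h1 d' \<le> - (y / 4)"
  proof -
    have "y * cos (d' - d) \<le> y * - (1 / 2)"
      using cos_le_minus_half[OF dd'] y0 by (intro mult_left_mono) auto
    moreover have "- (b * sin (d' - d)) \<le> 1" using trig[of "- sin (d' - d)"] sin_ge_minus_one[of "d' - d"] by simp
    moreover have "h1 d' \<le> y * cos (d' - d) - b * sin (d' - d) + B * (d' - d)"
      using h1_upper[of d d'] bulk d(3) dd by (simp add: y_def)
    ultimately have "h1 d' \<le> 1 - y / 2 + 5 * B" using piB[OF dd'(2)] by simp
    thus ?thesis using y20 B_nonneg by simp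
  qed
  hence "h1 d' < 0" using y0 by simp
  from valley_entry[OF d'(3) this] obtain a' where a': "d' < a'" "a' \<le> d' + pi / 8" "h1 a' = 0"
    "\<And>t. d' \<le> t \<Longrightarrow> t < a' \<Longrightarrow> h1 t < 0" "\<And>t. d' < t \<Longrightarrow> t \<le> a' \<Longrightarrow> h t < b" by blast
  have val': "h t \<le> b \<and> h1 t \<le> 0" if "d' \<le> t" "t \<le> a'" for t
    using a'(3) a'(4,5)[of t] d'(3) that by (cases "t = d'"; cases "t = a'") (auto simp: less_imp_le)
  have "(h1 d')\<^sup>2 \<le> 2 * (M + m) * gam (h a')"
    using energy_le_fall[of d' a'] val' a'(1,3) d'(3) by (simp add: gam_def algebra_simps)
  moreover have "(y / 4)\<^sup>2 \<le> (h1 d')\<^sup>2"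
    using power_mono[of "y / 4" "- h1 d'" 2] slope y0 by simp
  \<comment> \<open>Squaring \<open>y / 4\<close> costs a factor 16 and the energy bound another 2,
    hence 32.\<close>
  ultimately have y_up': "y\<^sup>2 \<le> 32 * (M + m) * gam (h a')"
    by (simp add: power_divide algebra_simps)
  hence gam': "m * gam (h a) \<le> 32 * (M + m) * gam (h a')" using y_low by linarith
  hence "32 * (M + m) * X \<le> 32 * (M + m) * gam (h a')" using gam by linarith
  hence gX': "X \<le> gam (h a')" using m by simp
  \<comment> \<open>Weakened to the constant 32 so that \<open>small\<close> covers both
    valleys.\<close>
  have "y\<^sup>2 \<le> 32 * (M + m) * gam (h a)"
  proof -
    have "2 * (M + m) * gam (h a) \<le> 32 * (M + m) * gam (h a)"
      using gX X0 m by (intro mult_right_mono) auto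
    thus ?thesis using y_up by linarith
  qed
  hence ha: "h a < m / 24 * y powr (p - 1)"
    using small[of "h a" "gam (h a)" y] gX gam_le[of "h a"] y0 a m by (cases "0 < h a") (auto intro: le_less_trans[of _ 0])
  have ha': "h a' < m / 24 * y powr (p - 1)"
    using small[of "h a'" "gam (h a')" y] gX' gam_le[of "h a'"] y_up' y0 a'(1) a'(5)[of a'] m
    by (cases "0 < h a'") (auto intro: le_less_trans[of _ 0])
  have long: "a + pi < a'"
  proof (rule ccontr)
    assume short: "\<not> ?thesis"
    \<comment> \<open>testing the equation with \<open>sin (t - a)\<close>: the arch alone contributes more than both end points\<close>
    define W where "W = (\<lambda>t. h1 t * sin (t - a) - h t * cos (t - a))"
    have dW: "(W has_real_derivative F t * sin (t - a)) (at t)" for t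
      unfolding W_def by (auto intro!: derivative_eq_intros dh dh1 simp: algebra_simps)
    have mono: "W u \<le> W v" if "a \<le> u" "u \<le> v" "v \<le> a'" for u v
    proof -
      have "0 \<le> F t * sin (t - a)" if "u \<le> t" "t \<le> v" for t
        using F_pos[of t] sin_ge_zero[of "t - a"] that short \<open>a \<le> u\<close> \<open>v \<le> a'\<close> by simp
      thus ?thesis using DERIV_ge_linear[OF that(2) dW, where B = 0] by simp
    qed
    \<comment> \<open>Lower bound of the integrand on a time window of length \<open>pi / 4\<close>:
      there \<open>h \<le> 2 * y\<close>, and \<open>t - a\<close> lies between
      \<open>pi / 6\<close> and \<open>5 * pi / 6\<close>, so the sine is at least
      \<open>1 / 2\<close>.\<close>
    define C where "C = m * (2 * y) powr (p - 1) * (1 / 2)"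
    have "C \<le> F t * sin (t - a)" if t: "d + pi / 4 \<le> t" "t \<le> d + pi / 2" for t
    proof -
      have td: "d \<le> t" "t \<le> d'" "t - d \<le> 4 * pi / 3" using t dd' pi_ge_two by auto
      have "h t \<le> b * cos (t - d) + y * sin (t - d) + B * (t - d)"
        using h_upper[of d t] bulk td d(3) by (simp add: y_def)
      moreover have "y * sin (t - d) \<le> y" using y0 by (simp add: mult_left_le)
      ultimately have "h t \<le> 2 * y" using trig[OF cos_le_one[of "t - d"]] piB[OF td(3)] y20 B_nonneg by argo
      moreover have "b \<le> h t" using bulk td by simp
      ultimately have "(2 * y) powr (p - 1) \<le> g (h t)"
        using e p by (simp add: trunc_powr_ge_powr powr_mono2')
      hence "m * (2 * y) powr (p - 1) \<le> m * g (h t)" using m(1) by (intro mult_left_mono) auto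
      hence "m * (2 * y) powr (p - 1) \<le> F t" using F_ge[of t] by linarith
      moreover have "1 / 2 \<le> sin (t - a)" using t d(1,2) pi_ge_two by (intro sin_ge_half) auto
      moreover have "0 \<le> m * (2 * y) powr (p - 1)" using m by simp
      ultimately show ?thesis unfolding C_def using F_pos[of t] by (intro mult_mono) auto
    qed
    hence "W (d + pi / 4) + C * (pi / 4) \<le> W (d + pi / 2)"
      using DERIV_ge_linear[OF _ dW, where a = "d + pi / 4" and b = "d + pi / 2" and B = C] pi_ge_two by simp
    moreover have "W a \<le> W (d + pi / 4)" "W (d + pi / 2) \<le> W a'"
      using mono[of a "d + pi / 4"] mono[of "d + pi / 2" a'] d(1) dd' a'(1) pi_ge_two by auto
    ultimately have W: "C * (pi / 4) \<le> W a' - W a" by linarith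
    have "(2::real) powr (-2) \<le> 2 powr (p - 1)" using p by (intro powr_mono) auto
    hence "1 / 4 \<le> (2::real) powr (p - 1)" by (simp add: powr_minus_divide)
    hence "1 / 4 * y powr (p - 1) \<le> (2 * y) powr (p - 1)"
      using y0 by (simp add: powr_mult)
    hence "m * (1 / 4 * y powr (p - 1)) * (1 / 2) \<le> C"
      unfolding C_def using m by (intro mult_right_mono mult_left_mono) auto
    hence "m * (1 / 4 * y powr (p - 1)) * (1 / 2) * (pi / 4) \<le> C * (pi / 4)" by (intro mult_right_mono) auto
    also note W
    finally have up: "m * (1 / 4 * y powr (p - 1)) * (1 / 2) * (pi / 4) \<le> W a' - W a" .
    \<comment> \<open>In units of \<open>m * y powr (p - 1)\<close>, the arch gives at least
      \<open>3 / 32\<close> since \<open>pi \<ge> 3\<close>, more than the \<open>2 / 24\<close>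
      that the two valleys can offer.\<close>
    have "3 / 32 * (m * y powr (p - 1)) = m * (1 / 4 * y powr (p - 1)) * (1 / 2) * (3 / 4)" by simp
    also have "\<dots> \<le> m * (1 / 4 * y powr (p - 1)) * (1 / 2) * (pi / 4)"
      using m pi_approx by (intro mult_left_mono) auto
    also note up
    also have "W a' - W a \<le> h a + max 0 (h a')"
    proof -
      \<comment> \<open>\<open>a' - a\<close> lies between \<open>2 * pi / 3\<close> and
        \<open>pi\<close>; with a nonpositive cosine, a negative \<open>h a'\<close> only
        helps.\<close>
      have c: "cos (a' - a) \<le> 0"
        using short dd' a'(1) d(1) pi_ge_two cos_le_minus_half[of "a' - a"] by fastforce
      have "- (h a' * cos (a' - a)) \<le> max 0 (h a')"
      proof (cases "0 \<le> h a'")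
        case True
        have "h a' * (- cos (a' - a)) \<le> h a' * 1" using True cos_ge_minus_one[of "a' - a"]
          by (intro mult_left_mono) auto
        thus ?thesis using True by simp
      next
        case False
        thus ?thesis using c by (simp add: mult_nonpos_nonpos)
      qed
      thus ?thesis using a a' by (simp add: W_def)
    qed
    also have "\<dots> < m / 24 * y powr (p - 1) + m / 24 * y powr (p - 1)"
    proof (rule add_strict_mono[OF ha])
      have "0 < m / 24 * y powr (p - 1)" using m y0 by simp
      thus "max 0 (h a') < m / 24 * y powr (p - 1)" using ha' by simp
    qed
    finally show False using m y0 by (simp add: field_simps)
  qed
  show ?thesis
  proof (rule that[OF long _ a'(3) _ gam'])
    \<comment> \<open>Both valley passages and the arch last at most
      \<open>pi / 8 + 4 * pi / 3 + pi / 8\<close>.\<close>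
    show "a' < a + 2 * pi" using a'(2) dd' d(2) pi_ge_two by auto
    show "h a' < b" using a' by simp
    \<comment> \<open>\<open>h1\<close> is positive on the ascent and negative on the descent, so
      critical points in between sit on the arch.\<close>
    fix t assume t: "a < t" "t < a'" "h1 t = 0"
    hence "d < t" using d(5)[of t] by force
    moreover have "t < d'" using a'(4)[of t] t by force
    ultimately show "b \<le> h t" using bulk[of t] by simp
  qed
qed

end

section \<open>A priori bounds\<close>

lemma continuous_on_trunc_powr:
  assumes "0 < e" "p \<le> 0"
  shows "continuous_on S (trunc_powr p e)"
proof (rule lipschitz_on_continuous_on[of "(1 - p) * e powr (p - 2)"])
  show "((1 - p) * e powr (p - 2))-lipschitz_on S (trunc_powr p e)"
    using trunc_powr_lipschitz[OF assms] assms by (intro lipschitz_onI) (auto simp: dist_real_def)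
qed

lemma circle_fun_reduce:
  assumes "circle_fun f"
  obtains n :: int where "0 \<le> t - of_int n * (2 * pi)" "t - of_int n * (2 * pi) < 2 * pi"
    "f t = f (t - of_int n * (2 * pi))"
proof -
  interpret periodic_fun_simple f "2 * pi" by fact
  define n where "n = \<lfloor>t / (2 * pi)\<rfloor>"
  have "of_int n \<le> t / (2 * pi)" "t / (2 * pi) < of_int n + 1" by (auto simp: n_def)
  hence "0 \<le> t - of_int n * (2 * pi)" "t - of_int n * (2 * pi) < 2 * pi"
    by (auto simp: field_simps)
  thus ?thesis using that[of n] minus_of_int[of t n] by simp
qed

lemma circle_fun_attains_inf:
  fixes f :: "real \<Rightarrow> real"
  assumes "circle_fun f" "continuous_on UNIV f"
  obtains a where "\<And>t. f a \<le> f t"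
proof -
  obtain a where a: "a \<in> {0..2 * pi}" "\<And>t. t \<in> {0..2 * pi} \<Longrightarrow> f a \<le> f t"
    using continuous_attains_inf[of "{0..2 * pi}" f] continuous_on_subset[OF assms(2)] by auto
  have "f a \<le> f t" for t
    using circle_fun_reduce[OF assms(1), of t] a(2) by (metis atLeastAtMost_iff less_imp_le)
  thus ?thesis using that by blast
qed

lemma circle_fun_attains_sup:
  fixes f :: "real \<Rightarrow> real"
  assumes "circle_fun f" "continuous_on UNIV f"
  obtains a where "\<And>t. f t \<le> f a"
proof -
  have "circle_fun (\<lambda>t. - f t)"
    using assms(1) by (simp add: periodic_fun_simple_def periodic_fun_def)
  thus ?thesis
    using circle_fun_attains_inf[of "\<lambda>t. - f t"] assms(2) that by (auto intro: continuous_on_minus)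
qed

lemma circle_fun_derivative:
  fixes h h1 :: "real \<Rightarrow> real"
  assumes "circle_fun h" "\<And>t. (h has_real_derivative h1 t) (at t)"
  shows "circle_fun h1"
proof
  fix t
  interpret h: periodic_fun_simple h "2 * pi" by fact
  have "((\<lambda>t. h (t + 2 * pi)) has_real_derivative h1 (t + 2 * pi) * 1) (at t)"
    by (rule DERIV_chain2[OF assms(2)]) (auto intro!: derivative_eq_intros)
  thus "h1 (t + 2 * pi) = h1 t" using DERIV_unique[OF assms(2)[of t]] unfolding h.plus_1 by simp
qed

text \<open>The forcing is existentially quantified so that only \<open>m\<close> and
  \<open>M\<close> can enter a bound; classical solutions with a small cut-off and all members of
  the homotopy are instances. \<open>h1\<close> is explicit in order to bound the initial data of
  the flow.\<close>

definition truncated_solution ::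
    "real \<Rightarrow> real \<Rightarrow> real \<Rightarrow> real \<Rightarrow> (real \<Rightarrow> real) \<Rightarrow> (real \<Rightarrow> real) \<Rightarrow> bool" where
  "truncated_solution p m M e h h1 \<longleftrightarrow> circle_fun h \<and> (\<forall>t. (h has_real_derivative h1 t) (at t)) \<and>
     (\<exists>F. \<forall>t. (h1 has_real_derivative F t - h t) (at t) \<and>
       m * trunc_powr p e (h t) \<le> F t \<and> F t \<le> M * trunc_powr p e (h t))"

text \<open>\<open>C\<close> is chosen before the cut-off \<open>e \<le> 1 / C\<close>, so every
  solution stays at or above the cut-off and never feels the truncation.\<close>

lemma truncated_solution_bounds:
  assumes p: "-1 < p" "p \<le> 0" and m: "0 < m" "m \<le> M"
  shows "\<exists>C\<ge>1. \<forall>e h h1. 0 < e \<and> e \<le> 1 / C \<and> truncated_solution p m M e h h1 \<longrightarrow>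
    (\<forall>t. 1 / C \<le> h t \<and> h t \<le> C \<and> \<bar>h1 t\<bar> \<le> C)"
proof -
  define k where "k = (1 - p) / 2"
  have k: "0 < k" "k < 1" "- 2 * k = p - 1" using p by (auto simp: k_def)
  define b where "b = min 1 (sqrt (m / 17))"
  have b: "0 < b" "b \<le> 1" using m by (auto simp: b_def)
  have "b\<^sup>2 \<le> (sqrt (m / 17))\<^sup>2" using b by (intro power_mono) (auto simp: b_def)
  hence b17: "17 * b\<^sup>2 \<le> m" using m by simp
  obtain X1 where X1: "\<And>u A y. \<lbrakk>0 < u; X1 \<le> A; A \<le> 2 / k * u powr (- k); 0 < y; y\<^sup>2 \<le> 32 * (M + m) * A\<rbrakk>
      \<Longrightarrow> u < m / 24 * y powr (p - 1)"
    using small_threshold[of "m / 24" "32 * (M + m)" k] k m by auto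
  define X where "X = max X1 (400 * (M * b powr (p - 1) + 1)\<^sup>2 / m)"
  have "0 \<le> M * b powr (p - 1)" using m by simp
  hence "0 < M * b powr (p - 1) + 1" by linarith
  hence "0 < 400 * (M * b powr (p - 1) + 1)\<^sup>2 / m" using m by simp
  hence X0: "0 < X" by (simp add: X_def less_max_iff_disj)
  have XB: "400 * (M * b powr (p - 1) + 1)\<^sup>2 \<le> m * X"
    using mult_left_mono[of "400 * (M * b powr (p - 1) + 1)\<^sup>2 / m" X m] m by (simp add: X_def)
  \<comment> \<open>\<open>q\<close> is the factor of potential that one bump may lose; two bumps
    cost \<open>q\<^sup>2\<close>.\<close>
  define q where "q = 32 * (M + m) / m"
  have q: "1 \<le> q" "m * q = 32 * (M + m)" using m by (auto simp: q_def)
  \<comment> \<open>Chosen with \<open>ln (b / c) = q\<^sup>2 * X\<close>: the potential drop from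
    \<open>b\<close> to \<open>c\<close> is at least \<open>ln (b / c)\<close>, as the truncated
    power is at least \<open>1 / x\<close> there.\<close>
  define c where "c = b * exp (- (q\<^sup>2 * X))"
  have c: "0 < c" "c < b" using b X0 q by (auto simp: c_def)
  define C where "C = max 1 (max (1 / c) (M * c powr (p - 1) * pi))"
  have C: "1 \<le> C" "1 / c \<le> C" "M * c powr (p - 1) * pi \<le> C" by (auto simp: C_def)
  have Cc: "1 / C \<le> c" using C c by (simp add: field_simps)
  show ?thesis
  proof (intro exI[of _ C] conjI[OF C(1)] allI impI, elim conjE)
    fix e h h1 t0
    assume e: "0 < e" "e \<le> 1 / C" and "truncated_solution p m M e h h1"
    then obtain F where per: "circle_fun h" and dh: "\<And>t. (h has_real_derivative h1 t) (at t)"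
      and dh1: "\<And>t. (h1 has_real_derivative F t - h t) (at t)"
      and F: "\<And>t. m * trunc_powr p e (h t) \<le> F t" "\<And>t. F t \<le> M * trunc_powr p e (h t)"
      unfolding truncated_solution_def by blast
    have ec: "e \<le> c" using e Cc by simp
    obtain G where dG: "\<And>x. (G has_real_derivative trunc_powr p e x) (at x)"
      using continuous_antiderivative[OF continuous_on_trunc_powr[OF e(1) p(2)]]
      by (auto simp: has_real_derivative_iff_has_vector_derivative)
    interpret oscillator p m M b e h h1 F G
      using p m b b17 e ec c dh dh1 F dG by unfold_locales auto
    interpret per: periodic_fun_simple h "2 * pi" by fact
    have small: "u < m / 24 * y powr (p - 1)"
      if "0 < u" "X \<le> A" "A \<le> 2 / ((1 - p) / 2) * u powr (- ((1 - p) / 2))" "0 < y" "y\<^sup>2 \<le> 32 * (M + m) * A"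
      for u A y using X1[of u A y] that by (auto simp: X_def k_def)
    have XB': "400 * (B + 1)\<^sup>2 \<le> m * X" using XB by (simp add: B_def)
    have next_valley: "\<exists>a'. a + pi < a' \<and> a' < a + 2 * pi \<and> h1 a' = 0 \<and> h a' < b \<and>
        m * gam (h a) \<le> 32 * (M + m) * gam (h a') \<and> (\<forall>t. a < t \<and> t < a' \<and> h1 t = 0 \<longrightarrow> b \<le> h t)"
      if "h1 a = 0" "h a < b" "32 * (M + m) * X \<le> m * gam (h a)" for a
      by (rule bump[OF XB' _ that]) (erule (4) small, blast)
    obtain a where a: "\<And>t. h a \<le> h t" using circle_fun_attains_inf[OF per h_cont] by blast
    have a0: "h1 a = 0" using DERIV_local_min[OF dh[of a], of 1] a by auto
    interpret per1: periodic_fun_simple h1 "2 * pi" by (rule circle_fun_derivative[OF per dh])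
    have lower: "c < h a"
    proof (rule ccontr)
      assume "\<not> c < h a"
      hence ha: "h a \<le> c" by simp
      have "G (h a) + 0 * (c - h a) \<le> G c"
        using ha trunc_powr_pos[OF e(1)] by (intro DERIV_ge_linear[OF _ dG]) (auto simp: less_imp_le)
      moreover have "G c - ln c + 0 * (b - c) \<le> G b - ln b"
      proof (rule DERIV_ge_linear)
        fix x assume x: "c \<le> x" "x \<le> b"
        show "((\<lambda>x. G x - ln x) has_real_derivative g x - 1 / x) (at x)"
          using x c by (auto intro!: derivative_eq_intros dG simp: field_simps)
        show "0 \<le> g x - 1 / x" using trunc_powr_ge_inverse[of e x p] x e ec b p by simp
      qed (use c in auto)
      moreover have "ln c = ln b - q\<^sup>2 * X" using b_pos by (simp add: c_def ln_mult)
      ultimately have gX: "q\<^sup>2 * X \<le> gam (h a)" by (simp add: gam_def)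
      have "q * X \<le> q\<^sup>2 * X" using q X0 by (simp add: power2_eq_square)
      hence "q * X \<le> gam (h a)" using gX by linarith
      hence "m * (q * X) \<le> m * gam (h a)" using m by simp
      hence g1: "32 * (M + m) * X \<le> m * gam (h a)" using q(2) by (simp add: mult.assoc[symmetric])
      \<comment> \<open>two bumps starting at \<open>a\<close> would overshoot the valley at \<open>a + 2 * pi\<close>\<close>
      have hb: "h a < b" using ha c by simp
      obtain a1 where a1: "a + pi < a1" "a1 < a + 2 * pi" "h1 a1 = 0" "h a1 < b"
        "m * gam (h a) \<le> 32 * (M + m) * gam (h a1)"
        using next_valley[OF a0 hb g1] by blast
      have "(m * q) * (q * X) = m * (q\<^sup>2 * X)" by (simp add: power2_eq_square)
      also have "\<dots> \<le> m * gam (h a)" using gX m by simp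
      also have "\<dots> \<le> (m * q) * gam (h a1)" using a1(5) unfolding q(2) .
      finally have "(m * q) * (q * X) \<le> (m * q) * gam (h a1)" .
      hence "q * X \<le> gam (h a1)" using m q by simp
      hence "m * (q * X) \<le> m * gam (h a1)" using m by simp
      hence g2: "32 * (M + m) * X \<le> m * gam (h a1)" using q(2) by (simp add: mult.assoc[symmetric])
      obtain a2 where a2: "a1 + pi < a2" "\<And>t. \<lbrakk>a1 < t; t < a2; h1 t = 0\<rbrakk> \<Longrightarrow> b \<le> h t"
        using next_valley[OF a1(3,4) g2] by blast
      have "b \<le> h (a + 2 * pi)" using a2(2)[of "a + 2 * pi"] per1.plus_1[of a] a0 a1 a2(1) by simp
      thus False using hb per.plus_1[of a] by simp
    qed
    obtain s where s: "\<And>t. h t \<le> h s" using circle_fun_attains_sup[OF per h_cont] by blast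
    have s0: "h1 s = 0" using DERIV_local_max[OF dh[of s], of 1] s by auto
    have "F u * sin (s + pi - u) \<le> M * c powr (p - 1)" for u
    proof -
      have hu: "c < h u" using lower a[of u] by simp
      hence "h u powr (p - 1) \<le> c powr (p - 1)" using c p by (intro powr_mono2') auto
      hence "M * g (h u) \<le> M * c powr (p - 1)" using hu ec m by (simp add: trunc_powr_ge_powr)
      hence "F u \<le> M * c powr (p - 1)" using F(2)[of u] by simp
      moreover have "F u * sin (s + pi - u) \<le> F u * 1" using F_pos[of u] by (intro mult_left_mono) auto
      ultimately show ?thesis by linarith
    qed
    hence "h (s + pi) \<le> - h s + M * c powr (p - 1) * pi"
      using DERIV_le_linear[OF _ rotate_h, of s "s + pi" "s + pi"] by simp
    hence hs: "h s \<le> C" using lower a[of "s + pi"] c C(3) by simp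
    \<comment> \<open>A quarter rotation forwards or backwards turns speed into height, so
      \<open>h1\<close> is bounded by the maximum of \<open>h\<close>.\<close>
    have "h1 t0 \<le> h (t0 + pi / 2)" using h_lower[of t0 "t0 + pi / 2"] pi_ge_two by simp
    moreover have "- h1 t0 \<le> h (t0 - pi / 2)"
    proof -
      have "F u * sin (t0 - pi / 2 - u) \<le> 0" if "t0 - pi / 2 \<le> u" "u \<le> t0" for u
      proof -
        have "0 \<le> sin (- (t0 - pi / 2 - u))" using that pi_ge_two by (intro sin_ge_zero) auto
        hence "sin (t0 - pi / 2 - u) \<le> 0" by (simp only: sin_minus)
        thus ?thesis using F_pos[of u] by (simp add: mult_nonneg_nonpos)
      qed
      thus ?thesis using DERIV_le_linear[OF _ rotate_h, of "t0 - pi / 2" t0 "t0 - pi / 2" 0] pi_ge_two by simp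
    qed
    ultimately have "\<bar>h1 t0\<bar> \<le> C" using s[of "t0 + pi / 2"] s[of "t0 - pi / 2"] hs by linarith
    thus "1 / C \<le> h t0 \<and> h t0 \<le> C \<and> \<bar>h1 t0\<bar> \<le> C"
      using s[of t0] hs lower a[of t0] Cc by auto
  qed
qed

section \<open>Flows with parameters and fixed points of homotopies\<close>

text \<open>The weight is that of a Bielecki norm: exponential growth integrates to at most
  \<open>K / c\<close> times its endpoint value, so a large \<open>c\<close> makes the Picard
  operator a contraction on the whole line.\<close>

lemma weighted_integral_bound:
  fixes f :: "real \<Rightarrow> 'a::euclidean_space"
  assumes "continuous_on {0..1} f" "0 < c" "0 \<le> K"
    and "\<And>s. 0 \<le> s \<Longrightarrow> s \<le> 1 \<Longrightarrow> norm (f s) \<le> \<bar>t\<bar> * K * exp (c * \<bar>t\<bar> * s)"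
  shows "exp (- c * \<bar>t\<bar>) * norm (integral {0..1} f) \<le> K / c"
proof -
  have "((\<lambda>s. \<bar>t\<bar> * K * exp (c * \<bar>t\<bar> * s)) has_integral
      K / c * exp (c * \<bar>t\<bar> * 1) - K / c * exp (c * \<bar>t\<bar> * 0)) {0..1}"
    using assms(2) by (intro fundamental_theorem_of_calculus)
      (auto intro!: derivative_eq_intros simp flip: has_real_derivative_iff_has_vector_derivative)
  hence *: "((\<lambda>s. \<bar>t\<bar> * K * exp (c * \<bar>t\<bar> * s)) has_integral K / c * (exp (c * \<bar>t\<bar>) - 1)) {0..1}"
    by (simp add: algebra_simps)
  have "norm (integral {0..1} f) \<le> K / c * (exp (c * \<bar>t\<bar>) - 1)"
    using assms integrable_continuous_real[OF assms(1)] integral_norm_bound_integral[of f "{0..1}"]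
      has_integral_integrable[OF *] integral_unique[OF *] by fastforce
  also have "\<dots> \<le> K / c * exp (c * \<bar>t\<bar>)" using assms by (intro mult_left_mono) auto
  finally have "exp (- c * \<bar>t\<bar>) * norm (integral {0..1} f) \<le> exp (- c * \<bar>t\<bar>) * (K / c * exp (c * \<bar>t\<bar>))"
    by (intro mult_left_mono) auto
  also have "\<dots> = K / c" by (simp add: exp_minus field_simps)
  finally show ?thesis .
qed

text \<open>Rescaled form of the integral of \<open>g\<close> from 0 to \<open>t\<close>, namely
  \<open>H t - H 0\<close> for an antiderivative \<open>H\<close>, for either sign of
  \<open>t\<close>.\<close>

lemma scaled_integral_derivative:
  fixes g :: "real \<Rightarrow> 'a::euclidean_space"
  assumes "continuous_on UNIV g"
  shows "((\<lambda>t. integral {0..1} (\<lambda>s. t *\<^sub>R g (t * s))) has_vector_derivative g t) (at t)"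
proof -
  obtain H where H: "\<And>t. (H has_vector_derivative g t) (at t)"
    using continuous_antiderivative[OF assms] by blast
  have *: "((\<lambda>s. H (t * s)) has_vector_derivative t *\<^sub>R g (t * s)) (at s)" for t s
    using vector_diff_chain_at[of "\<lambda>s. t * s" t s H "g (t * s)"] H
    by (auto simp: o_def intro!: derivative_eq_intros simp flip: has_real_derivative_iff_has_vector_derivative)
  have "integral {0..1} (\<lambda>s. t *\<^sub>R g (t * s)) = H (t * 1) - H (t * 0)" for t
    by (rule integral_unique, rule fundamental_theorem_of_calculus)
      (use * in \<open>auto intro: has_vector_derivative_at_within\<close>)
  thus ?thesis using has_vector_derivative_diff[OF H[of t] has_vector_derivative_const[of "H 0"]] by simp
qed

text \<open>The parameter \<open>q\<close> carries the equation and the initial value together. A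
  fixed point sought among bounded continuous functions of \<open>(t, q)\<close> is jointly
  continuous from the outset, as the time map requires.\<close>

lemma parametrised_flow:
  fixes A :: "real \<Rightarrow> 'p::metric_space \<Rightarrow> 'a::euclidean_space \<Rightarrow> 'a" and z :: "'p \<Rightarrow> 'a"
  assumes contA: "continuous_on UNIV (\<lambda>(t, q, u). A t q u)"
    and lip: "\<And>t q u v. norm (A t q u - A t q v) \<le> L * norm (u - v)"
    and bdd: "\<And>t q. norm (A t q 0) \<le> A0"
    and contz: "continuous_on UNIV z" and bddz: "\<And>q. norm (z q) \<le> Z"
  shows "\<exists>u :: real \<times> 'p \<Rightarrow> 'a. continuous_on UNIV u \<and> (\<forall>q. u (0, q) = z q) \<and>
    (\<forall>t q. ((\<lambda>t. u (t, q)) has_vector_derivative A t q (u (t, q))) (at t))"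
proof -
  define l where "l = max L 0"
  have l: "0 \<le> l" "\<And>t q u v. norm (A t q u - A t q v) \<le> l * norm (u - v)"
    using lip by (auto simp: l_def intro: order_trans[OF lip mult_right_mono])
  have A0: "0 \<le> A0" using bdd[of undefined undefined] norm_ge_zero order_trans by blast
  \<comment> \<open>This makes the contraction factor \<open>l / c\<close> at most
    \<open>1 / 2\<close>.\<close>
  define c where "c = 2 * l + 1"
  have c: "0 < c" "l / c \<le> 1 / 2" using l by (auto simp: c_def field_simps)
  \<comment> \<open>Picard iteration for \<open>v (t, q) = exp (- c * \<bar>t\<bar>) *\<^sub>R u (t, q)\<close>, a contraction in the
    sup norm over all times and parameters; integrating over \<open>{0..1}\<close> instead of \<open>{0..t}\<close>
    covers both signs of \<open>t\<close> and gives joint continuity\<close>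
  define f where "f = (\<lambda>(v :: real \<times> 'p \<Rightarrow> 'a) x s.
      fst x *\<^sub>R A (fst x * s) (snd x) (exp (c * \<bar>fst x * s\<bar>) *\<^sub>R v (fst x * s, snd x)))"
  define J where "J = (\<lambda>v x. z (snd x) + integral {0..1} (f v x))"
  define T where "T = (\<lambda>v x. exp (- c * \<bar>fst x\<bar>) *\<^sub>R J v x)"
  have contf: "continuous_on UNIV (\<lambda>(x, s). f v x s)" if "continuous_on UNIV v" for v
  proof -
    have A': "continuous_on UNIV (\<lambda>y. A (t y) (q y) (u y))"
      if "continuous_on UNIV t" "continuous_on UNIV q" "continuous_on UNIV u"
      for t :: "(real \<times> 'p) \<times> real \<Rightarrow> real" and q u
      using continuous_on_compose2[OF contA continuous_on_Pair[OF that(1) continuous_on_Pair[OF that(2,3)]]] by simp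
    have "continuous_on UNIV (\<lambda>y :: (real \<times> 'p) \<times> real. v (fst (fst y) * snd y, snd (fst y)))"
      by (rule continuous_on_compose2[OF that]) (auto intro!: continuous_intros)
    thus ?thesis
      unfolding f_def case_prod_unfold by (auto intro!: continuous_intros A')
  qed
  have contJ: "continuous_on UNIV (J v)" if "continuous_on UNIV v" for v
  proof -
    have "continuous_on UNIV (\<lambda>x. integral (cbox 0 1) (f v x))"
      by (rule integral_continuous_on_param) (rule continuous_on_subset[OF contf[OF that]], simp)
    moreover have "continuous_on UNIV (\<lambda>x :: real \<times> 'p. z (snd x))"
      by (rule continuous_on_compose2[OF contz]) (auto intro!: continuous_intros)
    ultimately show ?thesis unfolding J_def cbox_interval by (intro continuous_on_add)
  qed
  have contf1: "continuous_on {0..1} (f v x)" if "continuous_on UNIV v" for v x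
  proof -
    have "continuous_on {0..1} (\<lambda>s. (x, s))"
      by (intro continuous_on_Pair continuous_on_const continuous_on_id)
    from continuous_on_compose2[OF contf[OF that] this] show ?thesis by simp
  qed
  \<comment> \<open>Linear growth of \<open>A\<close> in the state is absorbed by the weight, so
    \<open>T\<close> preserves boundedness uniformly in time.\<close>
  have T_in: "T (apply_bcontfun v) \<in> bcontfun" for v
  proof -
    obtain V where V: "\<And>x. norm (apply_bcontfun v x) \<le> V"
      using bounded_apply_bcontfun[of v] unfolding bounded_iff by auto
    have V0: "0 \<le> V" using V norm_ge_zero order_trans by blast
    have "norm (T v x) \<le> Z + (A0 + l * V) / c" for x
    proof -
      have "norm (f v x s) \<le> \<bar>fst x\<bar> * (A0 + l * V) * exp (c * \<bar>fst x\<bar> * s)"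
        if s: "0 \<le> s" "s \<le> 1" for s
      proof -
        define E where "E = exp (c * \<bar>fst x\<bar> * s)"
        have E: "1 \<le> E" using c s by (simp add: E_def)
        define w where "w = exp (c * \<bar>fst x * s\<bar>) *\<^sub>R v (fst x * s, snd x)"
        have "norm w \<le> E * V"
          using V s by (simp add: w_def E_def abs_mult mult.assoc)
        hence "norm (A (fst x * s) (snd x) w) \<le> A0 + l * (E * V)"
          using norm_triangle_le[of "A (fst x * s) (snd x) w - A (fst x * s) (snd x) 0" "A (fst x * s) (snd x) 0"]
            l(2)[of "fst x * s" "snd x" w 0] bdd[of "fst x * s" "snd x"] l(1)
          by (smt (verit) diff_zero mult_left_mono norm_diff_triangle_ineq norm_triangle_ineq2 norm_triangle_sub)
        also have "\<dots> \<le> A0 * E + l * (E * V)" using E A0 by (simp add: mult_left_le mult_le_cancel_left1)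
        also have "\<dots> = (A0 + l * V) * E" by (simp add: algebra_simps)
        finally show ?thesis
          by (simp add: f_def w_def E_def mult_left_mono mult.assoc)
      qed
      hence "exp (- c * \<bar>fst x\<bar>) * norm (integral {0..1} (f v x)) \<le> (A0 + l * V) / c"
        using weighted_integral_bound[OF contf1 c(1), of v "A0 + l * V" x "fst x"] l A0 V0 by auto
      moreover have "exp (- c * \<bar>fst x\<bar>) * norm (z (snd x)) \<le> 1 * Z"
        using c bddz by (intro mult_mono) (auto simp: mult_nonneg_nonneg)
      moreover have "norm (T v x) \<le> exp (- c * \<bar>fst x\<bar>) * norm (z (snd x)) + exp (- c * \<bar>fst x\<bar>) * norm (integral {0..1} (f v x))"
        using norm_triangle_ineq[of "z (snd x)" "integral {0..1} (f v x)"]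
        by (simp add: T_def J_def flip: distrib_left)
      ultimately show ?thesis by linarith
    qed
    moreover have "continuous_on UNIV (T v)"
      unfolding T_def by (intro continuous_intros contJ) auto
    ultimately show ?thesis unfolding bcontfun_def bounded_iff by auto
  qed
  have ap: "apply_bcontfun (Bcontfun (T (apply_bcontfun v))) = T (apply_bcontfun v)" for v
    by (rule Bcontfun_inverse[OF T_in])
  have "dist (Bcontfun (T (apply_bcontfun v))) (Bcontfun (T (apply_bcontfun w))) \<le> 1 / 2 * dist v w" for v w
  proof (rule dist_bound)
    fix x
    have "norm (f v x s - f w x s) \<le> \<bar>fst x\<bar> * (l * dist v w) * exp (c * \<bar>fst x\<bar> * s)"
      if s: "0 \<le> s" "s \<le> 1" for s
    proof -
      let ?E = "exp (c * \<bar>fst x * s\<bar>)"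
      have "norm (f v x s - f w x s) \<le> \<bar>fst x\<bar> * (l * norm (?E *\<^sub>R v (fst x * s, snd x) - ?E *\<^sub>R w (fst x * s, snd x)))"
        unfolding f_def scaleR_diff_right[of "fst x", symmetric] norm_scaleR
        by (intro mult_left_mono l(2)) simp
      also have "\<dots> = \<bar>fst x\<bar> * (l * (?E * dist (v (fst x * s, snd x)) (w (fst x * s, snd x))))"
        by (simp add: dist_norm flip: scaleR_diff_right)
      also have "\<dots> \<le> \<bar>fst x\<bar> * (l * (?E * dist v w))"
        using l(1) by (intro mult_left_mono dist_bounded) auto
      also have "?E = exp (c * \<bar>fst x\<bar> * s)" using s by (simp add: abs_mult mult.assoc)
      finally show ?thesis by (simp add: mult_ac)
    qed
    hence "exp (- c * \<bar>fst x\<bar>) * norm (integral {0..1} (\<lambda>s. f v x s - f w x s)) \<le> (l * dist v w) / c"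
      using weighted_integral_bound[OF continuous_on_diff[OF contf1 contf1] c(1), of v w "l * dist v w" x x "fst x"] l
      by auto
    also have "\<dots> = l / c * dist v w" by simp
    also have "\<dots> \<le> 1 / 2 * dist v w" using c by (intro mult_right_mono) auto
    also have "integral {0..1} (\<lambda>s. f v x s - f w x s) = J v x - J w x"
      using integrable_continuous_real[OF contf1[of v x]] integrable_continuous_real[OF contf1[of w x]]
      by (simp add: J_def integral_diff)
    finally show "dist (Bcontfun (T v) x) (Bcontfun (T w) x) \<le> 1 / 2 * dist v w"
      unfolding ap by (simp add: T_def dist_norm flip: scaleR_diff_right)
  qed
  then obtain v where "Bcontfun (T (apply_bcontfun v)) = v"
    using banach_fix_type[of "1 / 2" "\<lambda>v. Bcontfun (T (apply_bcontfun v))"] by auto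
  hence v: "T v x = v x" for x using ap by metis
  define u where "u = J v"
  have contu: "continuous_on UNIV u" unfolding u_def by (rule contJ) simp
  have u: "u (t, q) = exp (c * \<bar>t\<bar>) *\<^sub>R v (t, q)" for t q
    using v[of "(t, q)", symmetric] by (simp add: T_def u_def exp_minus)
  have f_u: "f v (t, q) s = t *\<^sub>R A (t * s) q (u (t * s, q))" for t q s
    by (simp add: f_def u)
  show ?thesis
  proof (intro exI[of _ u] conjI allI contu)
    show "u (0, q) = z q" for q by (simp add: u_def J_def f_def)
    fix t q
    have "continuous_on UNIV (\<lambda>t. A t q (u (t, q)))"
    proof -
      have "continuous_on UNIV (\<lambda>t. (t, q, u (t, q)))"
        by (intro continuous_intros continuous_on_compose2[OF contu]) auto
      from continuous_on_compose2[OF contA this] show ?thesis by simp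
    qed
    from scaled_integral_derivative[OF this, of t]
    have "((\<lambda>t. z q + integral {0..1} (f v (t, q))) has_vector_derivative A t q (u (t, q))) (at t)"
      unfolding f_u[abs_def] using has_vector_derivative_add[OF has_vector_derivative_const[of "z q"]] by fastforce
    thus "((\<lambda>t. u (t, q)) has_vector_derivative A t q (u (t, q))) (at t)"
      by (simp add: u_def J_def)
  qed
qed

text \<open>Continuation without degree theory: fixed points of the homotopy stay off the frontier,
  so a variable parameter \<open>\<tau>\<close> and the nearest-point projection reduce the claim to
  Brouwer's theorem for one map.\<close>

lemma homotopy_fixed_point:
  fixes P :: "real \<times> 'a::euclidean_space \<Rightarrow> 'a"
  assumes K: "compact K" "convex K" "K \<noteq> {}"
    and contP: "continuous_on ({0..1} \<times> K) P"
    and P1: "\<And>x. x \<in> K \<Longrightarrow> P (1, x) \<in> K"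
    and frontier: "\<And>s x. \<lbrakk>0 \<le> s; s \<le> 1; x \<in> frontier K\<rbrakk> \<Longrightarrow> P (s, x) \<noteq> x"
  shows "\<exists>x\<in>K. P (0, x) = x"
proof -
  define S where "S = snd ` {y \<in> {0..1} \<times> K. P y = snd y}"
  define R where "R = {0..1} \<times> K \<inter> (\<lambda>y. P y - snd y) -` {0}"
  have cK: "compact ({0..1::real} \<times> K)" using K(1) by (intro compact_Times) auto
  have "closed R"
    unfolding R_def using contP cK
    by (intro continuous_closed_preimage continuous_intros compact_imp_closed) auto
  hence "compact R" using cK compact_Int_closed[OF cK, of R] by (simp add: R_def Int_assoc[symmetric])
  moreover have "S = snd ` R" unfolding S_def R_def by auto
  ultimately have "compact S"
    by (simp add: compact_continuous_image continuous_on_snd continuous_on_id)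
  moreover have "S \<inter> frontier K = {}" using frontier by (auto simp: S_def)
  ultimately obtain \<tau> :: "'a \<Rightarrow> real" where \<tau>: "continuous_on UNIV \<tau>"
    "\<And>x. \<tau> x \<in> closed_segment 0 1" "\<And>x. x \<in> S \<Longrightarrow> \<tau> x = 0" "\<And>x. x \<in> frontier K \<Longrightarrow> \<tau> x = 1"
    using Urysohn[of S "frontier K" 0 1] by (auto simp: compact_imp_closed)
  have \<tau>01: "0 \<le> \<tau> x" "\<tau> x \<le> 1" for x using \<tau>(2)[of x] by (auto simp: closed_segment_eq_real_ivl)
  \<comment> \<open>\<open>\<tau>\<close> turns the homotopy into a single map, which is \<open>P (1, _)\<close> on the frontier and
    \<open>P (0, _)\<close> wherever some map of the homotopy has a fixed point\<close>
  define Q where "Q = (\<lambda>x. closest_point K (P (\<tau> x, x)))"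
  have "continuous_on K (\<lambda>x. P (\<tau> x, x))"
    by (rule continuous_on_compose2[OF contP])
      (auto intro!: continuous_intros continuous_on_subset[OF \<tau>(1)] simp: \<tau>01)
  hence "continuous_on K Q"
    unfolding Q_def using K compact_imp_closed
    by (intro continuous_on_compose2[OF continuous_on_closest_point[of K UNIV]]) auto
  moreover have "Q \<in> K \<rightarrow> K"
    unfolding Q_def using K closest_point_in_set compact_imp_closed by blast
  ultimately obtain x where x: "x \<in> K" "Q x = x" using brouwer K by blast
  show ?thesis
  proof (cases "P (\<tau> x, x) \<in> K")
    case True
    hence "P (\<tau> x, x) = x" using x by (simp add: Q_def closest_point_self)
    moreover from this have "x \<in> S" using \<tau>01[of x] x by (force simp: S_def)
    ultimately show ?thesis using \<tau>(3) x by auto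
  next
    case False
    \<comment> \<open>The projection of a point outside \<open>K\<close> lands on the frontier; if
      \<open>K\<close> has empty interior, all of \<open>K\<close> is frontier. There
      \<open>\<tau> x = 1\<close>, so \<open>P (1, x)\<close> would have to lie outside
      \<open>K\<close>.\<close>
    have "x \<in> frontier K"
    proof (cases "interior K = {}")
      case True
      thus ?thesis using x K(1) by (auto simp: frontier_def closure_closed compact_imp_closed)
    next
      case ne: False
      hence "affine hull K = UNIV" by (rule affine_hull_nonempty_interior)
      hence "P (\<tau> x, x) \<in> affine hull K - rel_interior K" using False rel_interior_subset[of K] by auto
      from closest_point_in_rel_frontier[OF compact_imp_closed[OF K(1)] K(3) this]
      show ?thesis using rel_frontier_nonempty_interior[OF ne] x by (simp add: Q_def)
    qed
    thus ?thesis using \<tau>(4)[of x] P1[of x] x False by simp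
  qed
qed

section \<open>Existence of periodic solutions\<close>

text \<open>Gronwall's argument for the squared distance \<open>N\<close>, whose derivative is at
  most \<open>2 * L * N\<close> in modulus; the sign of \<open>r\<close> in the integrating factor
  \<open>exp (r * t)\<close> depends on that of \<open>t\<close>.\<close>

lemma ode_unique:
  fixes a b :: "real \<Rightarrow> 'a::real_inner"
  assumes a: "\<And>t. (a has_vector_derivative A t (a t)) (at t)"
    and b: "\<And>t. (b has_vector_derivative A t (b t)) (at t)"
    and lip: "\<And>t u v. norm (A t u - A t v) \<le> L * norm (u - v)"
    and "a 0 = b 0"
  shows "a t = b t"
proof -
  define N where "N = (\<lambda>t. (a t - b t) \<bullet> (a t - b t))"
  define D where "D = (\<lambda>t. 2 * ((a t - b t) \<bullet> (A t (a t) - A t (b t))))"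
  have dN: "(N has_real_derivative D t) (at t)" for t
    unfolding N_def D_def has_real_derivative_iff_has_vector_derivative
    using bounded_bilinear.has_vector_derivative[OF bounded_bilinear_inner
        has_vector_derivative_diff[OF a[of t] b[of t]] has_vector_derivative_diff[OF a[of t] b[of t]]]
    by (simp add: inner_commute)
  have D: "\<bar>D t\<bar> \<le> 2 * L * N t" for t
  proof -
    have "\<bar>(a t - b t) \<bullet> (A t (a t) - A t (b t))\<bar> \<le> norm (a t - b t) * norm (A t (a t) - A t (b t))"
      by (rule Cauchy_Schwarz_ineq2)
    also have "\<dots> \<le> norm (a t - b t) * (L * norm (a t - b t))"
      by (intro mult_left_mono lip) auto
    also have "\<dots> = L * N t" by (simp add: N_def dot_square_norm power2_eq_square)
    finally show ?thesis by (simp add: D_def abs_mult)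
  qed
  have N0: "N 0 = 0" using assms(4) by (simp add: N_def)
  have d: "((\<lambda>t. exp (r * t) * N t) has_real_derivative exp (r * t) * (D t + r * N t)) (at t)" for r t
    by (auto intro!: derivative_eq_intros dN simp: algebra_simps)
  have "exp (r * t) * N t \<le> 0" if r: "r = (if 0 \<le> t then - 2 * L else 2 * L)" for r
  proof (cases "0 \<le> t")
    case True
    have "exp (r * s) * (D s + r * N s) \<le> 0" for s
      using D[of s] True r by (intro mult_nonneg_nonpos) auto
    thus ?thesis using DERIV_le_linear[OF True d[where r = r], where B = 0] N0 by simp
  next
    case False
    have "0 \<le> exp (r * s) * (D s + r * N s)" for s
      using D[of s] False r by (intro mult_nonneg_nonneg) auto
    thus ?thesis using DERIV_ge_linear[OF _ d[where r = r], where a = t and b = 0 and B = 0] False N0 by simp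
  qed
  hence "N t \<le> 0" by (simp add: mult_le_0_iff)
  hence "(a t - b t) \<bullet> (a t - b t) = 0" unfolding N_def using inner_ge_zero[of "a t - b t"] by linarith
  thus ?thesis by simp
qed

section \<open>Energy of the autonomous equation\<close>

locale energy =
  fixes p e :: real and G :: "real \<Rightarrow> real"
  assumes p_nonpos: "p \<le> 0" and e_pos: "0 < e"
    and dG: "\<And>x. (G has_real_derivative trunc_powr p e x) (at x)"
begin

text \<open>Potential plus kinetic energy of \<open>x'' + x = trunc_powr p e x\<close>, on pairs of
  position and velocity.\<close>

definition energy :: "real \<times> real \<Rightarrow> real" where
  "energy u = ((fst u)\<^sup>2 / 2 - G (fst u)) + (snd u)\<^sup>2 / 2"

lemma continuous_energy: "continuous_on S energy"
proof -
  have "continuous_on UNIV G" using dG by (meson DERIV_isCont continuous_at_imp_continuous_on)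
  from continuous_on_compose2[OF this continuous_on_fst[OF continuous_on_id], of S]
  have "continuous_on S (\<lambda>u :: real \<times> real. G (fst u))" by simp
  thus ?thesis unfolding energy_def by (intro continuous_intros) auto
qed

text \<open>The potential has derivative \<open>x - trunc_powr p e x\<close>, which is increasing
  because the truncated power is decreasing.\<close>

lemma convex_sublevel: "convex {u. energy u \<le> c}"
proof (rule convexI)
  fix u v :: "real \<times> real" and \<alpha> \<beta> :: real
  assume uv: "u \<in> {u. energy u \<le> c}" "v \<in> {u. energy u \<le> c}" and ab: "0 \<le> \<alpha>" "0 \<le> \<beta>" "\<alpha> + \<beta> = 1"
  have V: "convex_on UNIV (\<lambda>x. x\<^sup>2 / 2 - G x)"
  proof (rule convex_on_realI)
    show "((\<lambda>x. x\<^sup>2 / 2 - G x) has_real_derivative x - trunc_powr p e x) (at x)" for x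
      by (auto intro!: derivative_eq_intros dG)
    show "x - trunc_powr p e x \<le> y - trunc_powr p e y" if "x \<le> y" for x y
      using trunc_powr_antimono[of e p x y] that p_nonpos e_pos by simp
  qed auto
  have S: "convex_on UNIV (\<lambda>y::real. y\<^sup>2 / 2)"
    by (rule convex_on_realI[where f' = "\<lambda>y. y"]) (auto intro!: derivative_eq_intros)
  have "energy (\<alpha> *\<^sub>R u + \<beta> *\<^sub>R v) \<le> \<alpha> * energy u + \<beta> * energy v"
  proof -
    have \<alpha>: "\<alpha> = 1 - \<beta>" and "\<beta> \<le> 1" using ab by auto
    thus ?thesis
      using convex_onD[OF V, of \<beta> "fst u" "fst v"] convex_onD[OF S, of \<beta> "snd u" "snd v"] ab(2)
      unfolding energy_def fst_add snd_add fst_scaleR snd_scaleR \<alpha> distrib_left by simp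
  qed
  also have "\<dots> \<le> \<alpha> * c + \<beta> * c" using uv ab by (intro add_mono mult_left_mono) auto
  also have "\<dots> = c" using ab by (simp flip: distrib_right)
  finally show "\<alpha> *\<^sub>R u + \<beta> *\<^sub>R v \<in> {u. energy u \<le> c}" by simp
qed

text \<open>\<open>G\<close> grows at most linearly, so the quadratic terms control the
  norm.\<close>

lemma compact_sublevel: "compact {u. energy u \<le> c}"
proof -
  let ?g = "trunc_powr p e 0"
  have G: "G x \<le> G 0 + ?g * \<bar>x\<bar>" for x
  proof (cases "0 \<le> x")
    case True
    thus ?thesis
      using DERIV_le_linear[OF True dG, of ?g] trunc_powr_antimono[of e p 0] p_nonpos e_pos by auto
  next
    case False
    hence "G x + 0 * (0 - x) \<le> G 0"
      using trunc_powr_pos[OF e_pos] by (intro DERIV_ge_linear[OF _ dG]) (auto simp: less_imp_le)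
    moreover have "0 \<le> ?g * \<bar>x\<bar>" using trunc_powr_pos[OF e_pos, of p 0] by simp
    ultimately show ?thesis by simp
  qed
  have "norm u \<le> sqrt (4 * (c + G 0 + ?g\<^sup>2))" if "energy u \<le> c" for u
  proof -
    have "0 \<le> (\<bar>fst u\<bar> / 2 - ?g)\<^sup>2" by simp
    hence "?g * \<bar>fst u\<bar> \<le> (fst u)\<^sup>2 / 4 + ?g\<^sup>2" by (simp add: power2_diff power_divide algebra_simps)
    moreover have "0 \<le> (snd u)\<^sup>2" by simp
    ultimately have "(fst u)\<^sup>2 + (snd u)\<^sup>2 \<le> 4 * (c + G 0 + ?g\<^sup>2)"
      using that G[of "fst u"] unfolding energy_def by argo
    thus ?thesis by (simp add: norm_prod_def)
  qed
  hence "bounded {u. energy u \<le> c}" unfolding bounded_iff by blast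
  moreover have "closed {u. energy u \<le> c}"
    by (intro closed_Collect_le continuous_energy continuous_on_const)
  ultimately show ?thesis by (simp add: compact_eq_bounded_closed)
qed

lemma frontier_sublevel:
  assumes "u \<in> frontier {u. energy u \<le> c}" shows "c \<le> energy u"
proof (rule ccontr)
  assume "\<not> ?thesis"
  hence "u \<in> {u. energy u < c}" by simp
  moreover have "open {u. energy u < c}"
    by (intro open_Collect_less continuous_energy continuous_on_const)
  hence "{u. energy u < c} \<subseteq> interior {u. energy u \<le> c}" by (intro interior_maximal) auto
  ultimately show False using assms unfolding frontier_def by blast
qed

end

lemma periodic_solution_exists:
  fixes f :: "real \<Rightarrow> real"
  assumes p: "-1 < p" "p \<le> 0"
    and per: "circle_fun f" and cont: "continuous_on UNIV f" and pos: "\<And>t. 0 < f t"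
  obtains h h1 where "circle_fun h" "\<And>t. 0 < h t" "\<And>t. (h has_real_derivative h1 t) (at t)"
    "\<And>t. (h1 has_real_derivative f t * h t powr (p - 1) - h t) (at t)"
proof -
  interpret f: periodic_fun_simple f "2 * pi" by fact
  obtain a0 where a0: "\<And>t. f a0 \<le> f t" using circle_fun_attains_inf[OF per cont] by blast
  obtain a1 where a1: "\<And>t. f t \<le> f a1" using circle_fun_attains_sup[OF per cont] by blast
  \<comment> \<open>Including 1 keeps every convex combination of \<open>f\<close> and 1 between
    \<open>m\<close> and \<open>M\<close>.\<close>
  define m where "m = min (f a0) 1"
  define M where "M = max (f a1) 1"
  have mM: "0 < m" "m \<le> 1" "1 \<le> M" using pos by (auto simp: m_def M_def)
  have fm: "m \<le> f t" "f t \<le> M" for t using a0[of t] a1[of t] by (auto simp: m_def M_def)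
  obtain C where C: "1 \<le> C"
    "\<And>e h h1 t. \<lbrakk>0 < e; e \<le> 1 / C; truncated_solution p m M e h h1\<rbrakk>
       \<Longrightarrow> 1 / C \<le> h t \<and> h t \<le> C \<and> \<bar>h1 t\<bar> \<le> C"
    using truncated_solution_bounds[OF p mM(1) order_trans[OF mM(2,3)]] by blast
  define e where "e = 1 / C"
  have e: "0 < e" using C(1) by (simp add: e_def)
  define g where "g = trunc_powr p e"
  have contg: "continuous_on S g" for S unfolding g_def using continuous_on_trunc_powr[OF e p(2)] .
  obtain G where dG: "\<And>x. (G has_real_derivative g x) (at x)"
    using continuous_antiderivative[OF contg]
    by (auto simp: has_real_derivative_iff_has_vector_derivative)
  interpret energy p e G using p e dG by unfold_locales (auto simp: g_def)
  obtain E0 where E0: "\<And>u. u \<in> cbox (0, - C) (C, C) \<Longrightarrow> energy u \<le> E0"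
  proof -
    have "bounded (energy ` cbox (0, - C) (C, C))"
      using compact_continuous_image[OF continuous_energy compact_cbox] compact_imp_bounded by blast
    thus ?thesis using that unfolding bounded_iff by (metis abs_le_D1 imageI real_norm_def)
  qed
  \<comment> \<open>\<open>E0\<close> bounds the energy on a box containing all initial data allowed
    by the a priori bounds; the extra 1 keeps them off the frontier of \<open>K\<close>.\<close>
  define K where "K = {u. energy u \<le> E0 + 1}"
  have K: "compact K" "convex K" unfolding K_def by (rule compact_sublevel convex_sublevel)+
  have "(0, 0) \<in> K" using E0[of "(0, 0)"] C(1) by (simp add: K_def cbox_Pair_eq)
  hence K0: "K \<noteq> {}" by auto
  obtain Z where Z: "\<And>u. u \<in> K \<Longrightarrow> norm u \<le> Z"
    using compact_imp_bounded[OF K(1)] unfolding bounded_iff by blast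
  \<comment> \<open>homotopy from \<open>f\<close> (at \<open>s = 0\<close>) to the autonomous equation (at \<open>s = 1\<close>),
    whose flow preserves the energy\<close>
  define \<phi> where "\<phi> = (\<lambda>s t. (1 - max 0 (min 1 s)) * f t + max 0 (min 1 s) * 1)"
  have \<phi>: "m \<le> \<phi> s t" "\<phi> s t \<le> M" for s t
  proof -
    let ?s = "max 0 (min 1 s)"
    have "(1 - ?s) * m + ?s * m \<le> \<phi> s t"
      unfolding \<phi>_def using fm mM by (intro add_mono mult_left_mono) auto
    thus "m \<le> \<phi> s t" by (simp add: algebra_simps)
    have "\<phi> s t \<le> (1 - ?s) * M + ?s * M"
      unfolding \<phi>_def using fm mM by (intro add_mono mult_left_mono) auto
    thus "\<phi> s t \<le> M" by (simp add: algebra_simps)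
  qed
  \<comment> \<open>A parameter \<open>q\<close> pairs the homotopy parameter with the initial
    point; the latter will be projected to \<open>K\<close> so that it stays bounded.\<close>
  define A where "A = (\<lambda>t (q :: real \<times> (real \<times> real)) (u :: real \<times> real).
      (snd u, \<phi> (fst q) t * g (fst u) - fst u))"
  define L where "L = 2 + M * ((1 - p) * e powr (p - 2))"
  have lip: "norm (A t q u - A t q v) \<le> L * norm (u - v)" for t q u v
  proof -
    have "\<bar>\<phi> (fst q) t\<bar> \<le> M" using \<phi>[of "fst q" t] mM by simp
    hence "\<bar>\<phi> (fst q) t\<bar> * \<bar>g (fst u) - g (fst v)\<bar> \<le> M * ((1 - p) * e powr (p - 2) * \<bar>fst u - fst v\<bar>)"
      unfolding g_def using trunc_powr_lipschitz[OF e p(2)] by (intro mult_mono) auto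
    hence "\<bar>\<phi> (fst q) t * (g (fst u) - g (fst v)) - (fst u - fst v)\<bar>
        \<le> M * ((1 - p) * e powr (p - 2) * \<bar>fst u - fst v\<bar>) + \<bar>fst u - fst v\<bar>"
      unfolding abs_mult[symmetric] by linarith
    moreover have "norm (A t q u - A t q v)
        \<le> \<bar>snd u - snd v\<bar> + \<bar>\<phi> (fst q) t * (g (fst u) - g (fst v)) - (fst u - fst v)\<bar>"
      using norm_Pair_le[of "snd u - snd v" "\<phi> (fst q) t * (g (fst u) - g (fst v)) - (fst u - fst v)"]
      by (simp add: A_def algebra_simps)
    moreover have "\<bar>snd u - snd v\<bar> \<le> norm (u - v)" using norm_snd_le[of "snd (u - v)" "fst (u - v)"] unfolding prod.collapse by simp
    moreover have uv: "\<bar>fst u - fst v\<bar> \<le> norm (u - v)" using norm_fst_le[of "fst (u - v)" "snd (u - v)"] unfolding prod.collapse by simp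
    moreover have "M * ((1 - p) * e powr (p - 2) * \<bar>fst u - fst v\<bar>) \<le> M * ((1 - p) * e powr (p - 2) * norm (u - v))"
      using uv mM p by (intro mult_left_mono) auto
    ultimately show ?thesis by (simp add: L_def algebra_simps)
  qed
  have "continuous_on UNIV (\<lambda>(t, q, u). A t q u)"
  proof -
    have "continuous_on UNIV (\<lambda>x :: real \<times> (real \<times> (real \<times> real)) \<times> (real \<times> real). f (fst x))"
      by (rule continuous_on_compose2[OF cont]) (auto intro!: continuous_intros)
    moreover have "continuous_on UNIV (\<lambda>x :: real \<times> (real \<times> (real \<times> real)) \<times> (real \<times> real). g (fst (snd (snd x))))"
      by (rule continuous_on_compose2[OF contg[of UNIV]]) (auto intro!: continuous_intros)
    ultimately show ?thesis
      unfolding A_def \<phi>_def case_prod_unfold by (auto intro!: continuous_intros)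
  qed
  moreover have "norm (A t q 0) \<le> M * g 0" for t q
    using \<phi>[of "fst q" t] mM trunc_powr_pos[OF e, of p 0] by (auto simp: A_def abs_mult g_def intro!: mult_mono)
  moreover have "continuous_on UNIV (\<lambda>q :: real \<times> real \<times> real. closest_point K (snd q))"
    by (rule continuous_on_compose2[OF continuous_on_closest_point[of K UNIV]])
      (use K K0 in \<open>auto intro!: continuous_intros compact_imp_closed\<close>)
  moreover have "norm (closest_point K (snd q)) \<le> Z" for q :: "real \<times> real \<times> real"
    using Z closest_point_in_set[OF compact_imp_closed[OF K(1)] K0] by blast
  ultimately obtain u where contu: "continuous_on UNIV u" and u0: "\<And>q. u (0, q) = closest_point K (snd q)"
    and du: "\<And>t q. ((\<lambda>t. u (t, q)) has_vector_derivative A t q (u (t, q))) (at t)"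
    using parametrised_flow[of A L "M * g 0" "\<lambda>q. closest_point K (snd q)" Z] lip by blast
  have dx: "((\<lambda>t. fst (u (t, q))) has_real_derivative snd (u (t, q))) (at t)" for t q
    using bounded_linear.has_vector_derivative[OF bounded_linear_fst du[of q t]]
    by (simp add: A_def has_real_derivative_iff_has_vector_derivative)
  have dy: "((\<lambda>t. snd (u (t, q))) has_real_derivative \<phi> (fst q) t * g (fst (u (t, q))) - fst (u (t, q))) (at t)" for t q
    using bounded_linear.has_vector_derivative[OF bounded_linear_snd du[of q t]]
    by (simp add: A_def has_real_derivative_iff_has_vector_derivative)
  define P where "P = (\<lambda>q. u (2 * pi, q))"
  have start: "u (0, (s, w)) = w" if "w \<in> K" for s w
    using that by (simp add: u0 closest_point_self)
  \<comment> \<open>The equation is periodic in time, so by uniqueness a fixed point of the time map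
    gives a periodic solution, which obeys the a priori bounds.\<close>
  have bounds: "circle_fun (\<lambda>t. fst (u (t, q))) \<and> (\<forall>t. 1 / C \<le> fst (u (t, q)) \<and> fst (u (t, q)) \<le> C \<and> \<bar>snd (u (t, q))\<bar> \<le> C)"
    if fp: "snd q \<in> K" "P q = snd q" for q
  proof -
    have "((\<lambda>t. u (t + 2 * pi, q)) has_vector_derivative A t q (u (t + 2 * pi, q))) (at t)" for t
    proof -
      have "((\<lambda>t. t + 2 * pi) has_vector_derivative 1) (at t)"
        by (auto intro!: derivative_eq_intros simp flip: has_real_derivative_iff_has_vector_derivative)
      from vector_diff_chain_at[OF this du[of q "t + 2 * pi"]]
      show ?thesis by (simp add: o_def A_def \<phi>_def f.plus_1)
    qed
    from ode_unique[OF this du[of q] lip] 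
    have per: "u (t + 2 * pi, q) = u (t, q)" for t
      using fp start[of "snd q" "fst q"] by (simp add: P_def)
    have 1: "circle_fun (\<lambda>t. fst (u (t, q)))" by unfold_locales (simp add: per)
    have "truncated_solution p m M e (\<lambda>t. fst (u (t, q))) (\<lambda>t. snd (u (t, q)))"
      unfolding truncated_solution_def
      using 1 dx dy[of q] mult_right_mono[OF \<phi>(1) less_imp_le[OF trunc_powr_pos[OF e]]]
        mult_right_mono[OF \<phi>(2) less_imp_le[OF trunc_powr_pos[OF e]]]
      by (auto simp: g_def intro!: exI[of _ "\<lambda>t. \<phi> (fst q) t * g (fst (u (t, q)))"])
    from C(2)[OF e _ this] show ?thesis using 1 by (simp add: e_def)
  qed
  have P1: "P (1, w) \<in> K" if w: "w \<in> K" for w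
  proof -
    let ?q = "(1, w)"
    have "((\<lambda>t. energy (u (t, ?q))) has_real_derivative 0) (at t)" for t
      unfolding energy_def
      by (auto intro!: derivative_eq_intros dx dy DERIV_chain2[OF dG dx] simp: \<phi>_def g_def field_simps)
    hence "energy (u (2 * pi, ?q)) = energy (u (0, ?q))" by (intro DERIV_isconst_all) auto
    thus ?thesis using w start[OF w, of 1] by (simp add: P_def K_def)
  qed
  have "P (s, w) \<noteq> w" if "w \<in> frontier K" for s w
  proof
    assume eq: "P (s, w) = w"
    have w: "w \<in> K" using that compact_imp_closed[OF K(1)] frontier_subset_closed by blast
    have "1 / C \<le> fst (u (0, (s, w))) \<and> fst (u (0, (s, w))) \<le> C \<and> \<bar>snd (u (0, (s, w)))\<bar> \<le> C"
      using bounds[of "(s, w)"] eq w by simp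
    hence "e \<le> fst w" "fst w \<le> C" "\<bar>snd w\<bar> \<le> C"
      using start[OF w, of s] by (auto simp: e_def)
    hence "w \<in> cbox (0, - C) (C, C)" using e by (auto simp: cbox_Pair_eq mem_Times_iff)
    hence "energy w \<le> E0" by (rule E0)
    moreover have "E0 + 1 \<le> energy w" using frontier_sublevel that by (simp add: K_def)
    ultimately show False by simp
  qed
  moreover have "continuous_on ({0..1} \<times> K) P"
    unfolding P_def by (rule continuous_on_compose2[OF contu]) (auto intro!: continuous_intros)
  ultimately obtain w where w: "w \<in> K" "P (0, w) = w"
    using homotopy_fixed_point[OF K K0, of P] P1 by blast
  define h where "h = (\<lambda>t. fst (u (t, (0, w))))"
  have h: "circle_fun h" "\<And>t. e \<le> h t" using bounds[of "(0, w)"] w by (auto simp: h_def e_def)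
  show ?thesis
  proof (rule that[OF h(1)])
    show "0 < h t" for t using e h(2)[of t] by simp
    show "(h has_real_derivative snd (u (t, (0, w)))) (at t)" for t unfolding h_def by (rule dx)
    show "((\<lambda>t. snd (u (t, (0, w)))) has_real_derivative f t * h t powr (p - 1) - h t) (at t)" for t
      using dy[of "(0, w)" t] h(2)[of t] by (simp add: \<phi>_def g_def h_def trunc_powr_ge_powr)
  qed
qed

section \<open>Hoelder functions on the circle\<close>

lemma holder_continuous:
  assumes "holder \<alpha> f" "0 < \<alpha>" shows "continuous_on S f"
proof -
  obtain K where K: "\<And>x y. \<bar>f x - f y\<bar> \<le> K * \<bar>x - y\<bar> powr \<alpha>"
    using assms(1) by (auto simp: holder_def)
  have "isCont f x" for x
  proof -
    have "((\<lambda>y. K * \<bar>y - x\<bar> powr \<alpha>) \<longlongrightarrow> K * \<bar>x - x\<bar> powr \<alpha>) (at x)"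
      using assms(2) by (intro tendsto_intros tendsto_powr') auto
    hence "((\<lambda>y. K * \<bar>y - x\<bar> powr \<alpha>) \<longlongrightarrow> 0) (at x)" by simp
    from Lim_null_comparison[OF always_eventually this, of "\<lambda>y. f y - f x"] K
    show ?thesis by (simp add: isCont_def LIM_zero_iff)
  qed
  thus ?thesis by (simp add: continuous_at_imp_continuous_on)
qed

lemma circle_fun_bounded:
  assumes "circle_fun f" "continuous_on UNIV (f :: real \<Rightarrow> real)"
  obtains B where "\<And>t. \<bar>f t\<bar> \<le> B"
proof -
  obtain a where a: "\<And>t. f a \<le> f t" using circle_fun_attains_inf[OF assms] by blast
  obtain b where b: "\<And>t. f t \<le> f b" using circle_fun_attains_sup[OF assms] by blast
  have "\<bar>f t\<bar> \<le> \<bar>f a\<bar> + \<bar>f b\<bar>" for t using a[of t] b[of t] by linarith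
  thus ?thesis using that by blast
qed

lemma holder_mult:
  assumes f: "holder \<alpha> f" and g: "holder \<alpha> g" and \<alpha>: "0 < \<alpha>"
  shows "holder \<alpha> (\<lambda>t. f t * g t)"
proof -
  have per: "circle_fun f" "circle_fun g" using f g by (auto simp: holder_def)
  obtain A where A: "\<And>t. \<bar>f t\<bar> \<le> A" using circle_fun_bounded[OF per(1) holder_continuous[OF f \<alpha>]] by blast
  obtain B where B: "\<And>t. \<bar>g t\<bar> \<le> B" using circle_fun_bounded[OF per(2) holder_continuous[OF g \<alpha>]] by blast
  obtain K where K: "\<And>x y. \<bar>f x - f y\<bar> \<le> K * \<bar>x - y\<bar> powr \<alpha>" using f by (auto simp: holder_def)
  obtain L where L: "\<And>x y. \<bar>g x - g y\<bar> \<le> L * \<bar>x - y\<bar> powr \<alpha>" using g by (auto simp: holder_def)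
  have "\<bar>f x * g x - f y * g y\<bar> \<le> (A * L + K * B) * \<bar>x - y\<bar> powr \<alpha>" for x y
  proof -
    have "f x * g x - f y * g y = f x * (g x - g y) + (f x - f y) * g y" by (simp add: algebra_simps)
    hence "\<bar>f x * g x - f y * g y\<bar> \<le> \<bar>f x\<bar> * \<bar>g x - g y\<bar> + \<bar>f x - f y\<bar> * \<bar>g y\<bar>"
      by (metis abs_mult abs_triangle_ineq)
    also have "\<dots> \<le> A * (L * \<bar>x - y\<bar> powr \<alpha>) + (K * \<bar>x - y\<bar> powr \<alpha>) * B"
      using A B K L order_trans[OF abs_ge_zero A] order_trans[OF abs_ge_zero K]
      by (intro add_mono mult_mono) auto
    finally show ?thesis by (simp add: algebra_simps)
  qed
  moreover have "circle_fun (\<lambda>t. f t * g t)"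
    using per by (simp add: periodic_fun_simple_def periodic_fun_def)
  ultimately show ?thesis unfolding holder_def by blast
qed

lemma holder_diff:
  assumes f: "holder \<alpha> f" and g: "holder \<alpha> g"
  shows "holder \<alpha> (\<lambda>t. f t - g t)"
proof -
  obtain K where K: "\<And>x y. \<bar>f x - f y\<bar> \<le> K * \<bar>x - y\<bar> powr \<alpha>" using f by (auto simp: holder_def)
  obtain L where L: "\<And>x y. \<bar>g x - g y\<bar> \<le> L * \<bar>x - y\<bar> powr \<alpha>" using g by (auto simp: holder_def)
  have "\<bar>(f x - g x) - (f y - g y)\<bar> \<le> (K + L) * \<bar>x - y\<bar> powr \<alpha>" for x y
    using K[of x y] L[of x y] unfolding distrib_right by linarith
  moreover have "circle_fun (\<lambda>t. f t - g t)"
    using f g by (simp add: holder_def periodic_fun_simple_def periodic_fun_def)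
  ultimately show ?thesis unfolding holder_def by blast
qed

text \<open>For distances up to 1,
  \<open>\<bar>x - y\<bar> \<le> \<bar>x - y\<bar> powr \<alpha>\<close>; for larger ones
  boundedness of the periodic function is enough.\<close>

lemma lipschitz_imp_holder:
  assumes per: "circle_fun f" and lip: "\<And>x y. \<bar>f x - f y\<bar> \<le> L * \<bar>x - y\<bar>" and \<alpha>: "0 < \<alpha>" "\<alpha> < 1"
  shows "holder \<alpha> f"
proof -
  have "L-lipschitz_on UNIV f"
    using lip order_trans[OF abs_ge_zero lip[of 1 0]] by (intro lipschitz_onI) (auto simp: dist_real_def)
  then obtain B where B: "\<And>t. \<bar>f t\<bar> \<le> B"
    using circle_fun_bounded[OF per lipschitz_on_continuous_on] by blast
  have L0: "0 \<le> L" using order_trans[OF abs_ge_zero lip[of 1 0]] by simp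
  have B0: "0 \<le> B" using order_trans[OF abs_ge_zero B] .
  have "\<bar>f x - f y\<bar> \<le> (L + 2 * B) * \<bar>x - y\<bar> powr \<alpha>" for x y
  proof (cases "\<bar>x - y\<bar> \<le> 1")
    case True
    have "\<bar>f x - f y\<bar> \<le> L * \<bar>x - y\<bar>" by (rule lip)
    also have "\<bar>x - y\<bar> \<le> \<bar>x - y\<bar> powr \<alpha>" using powr_mono'[of \<alpha> 1 "\<bar>x - y\<bar>"] True \<alpha> by simp
    also have "L * \<dots> \<le> (L + 2 * B) * \<bar>x - y\<bar> powr \<alpha>" using B0 by (intro mult_right_mono) auto
    finally show ?thesis using L0 mult_left_mono by blast
  next
    case False
    hence "1 \<le> \<bar>x - y\<bar> powr \<alpha>" using \<alpha> by (intro ge_one_powr_ge_zero) auto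
    hence "L + 2 * B \<le> (L + 2 * B) * \<bar>x - y\<bar> powr \<alpha>"
      using mult_left_mono[of 1 "\<bar>x - y\<bar> powr \<alpha>" "L + 2 * B"] L0 B0 by simp
    moreover have "\<bar>f x - f y\<bar> \<le> 2 * B" using B[of x] B[of y] by linarith
    ultimately show ?thesis using L0 by linarith
  qed
  thus ?thesis using per unfolding holder_def by blast
qed

section \<open>Hoelder data and classical solutions\<close>

lemma holder_bounds:
  assumes f: "holder \<alpha> f" "0 < \<alpha>" and pos: "\<And>t. 0 < f t"
  shows "0 < circle_min f" "circle_min f \<le> f t" "f t \<le> holder_norm \<alpha> f"
proof -
  have per: "circle_fun f" using f by (simp add: holder_def)
  note cont = holder_continuous[OF f]
  obtain a where a: "\<And>t. f a \<le> f t" using circle_fun_attains_inf[OF per cont] by blast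
  have "circle_min f = f a" unfolding circle_min_def using a by (intro cInf_eq_minimum) auto
  thus "0 < circle_min f" "circle_min f \<le> f t" using pos a by auto
  obtain B where B: "\<And>t. \<bar>f t\<bar> \<le> B" using circle_fun_bounded[OF per cont] by blast
  have 1: "\<bar>f t\<bar> \<le> (SUP x. \<bar>f x\<bar>)" using B by (intro cSUP_upper) (auto intro!: bdd_aboveI)
  obtain K where K: "\<And>x y. \<bar>f x - f y\<bar> \<le> K * \<bar>x - y\<bar> powr \<alpha>" using f by (auto simp: holder_def)
  \<comment> \<open>Boundedness makes the supremum over pairs genuine, so comparison with the pair
    \<open>(0, 1)\<close> gives nonnegativity.\<close>
  have "bdd_above ((\<lambda>(x, y). \<bar>f x - f y\<bar> / \<bar>x - y\<bar> powr \<alpha>) ` {(x, y). x \<noteq> y})"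
    using K by (intro bdd_aboveI[of _ K]) (auto simp: divide_le_eq)
  hence "(\<lambda>(x, y). \<bar>f x - f y\<bar> / \<bar>x - y\<bar> powr \<alpha>) (0, 1) \<le> holder_seminorm \<alpha> f"
    unfolding holder_seminorm_def by (intro cSUP_upper) auto
  hence "0 \<le> holder_seminorm \<alpha> f" by (auto intro: order_trans[OF abs_ge_zero])
  thus "f t \<le> holder_norm \<alpha> f" using 1 by (simp add: holder_norm_def)
qed

text \<open>A cut-off at or below the minimum of \<open>h\<close> leaves the equation along
  \<open>h\<close> unchanged, so \<open>e0\<close> is that minimum.\<close>

lemma positive_classical_solution_truncated:
  assumes sol: "positive_classical_solution p \<alpha> f h" and p: "p \<le> 0" and f: "\<And>t. m \<le> f t" "\<And>t. f t \<le> M"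
  obtains e0 where "0 < e0" "\<And>e. e \<le> e0 \<Longrightarrow> truncated_solution p m M e h (deriv h)"
proof -
  have per: "circle_fun h" and pos: "\<And>t. 0 < h t"
    and eq: "\<And>t. deriv (deriv h) t = f t * h t powr (p - 1) - h t"
    using sol by (auto simp: positive_classical_solution_def C2_holder_def algebra_simps eq_diff_eq)
  have d: "(h has_real_derivative deriv h t) (at t)"
    "(deriv h has_real_derivative deriv (deriv h) t) (at t)" for t
    using sol unfolding positive_classical_solution_def C2_holder_def
    by (auto simp: DERIV_deriv_iff_real_differentiable[symmetric])
  have "continuous_on UNIV h" using d by (meson DERIV_isCont continuous_at_imp_continuous_on)
  then obtain a where a: "\<And>t. h a \<le> h t" using circle_fun_attains_inf[OF per] by blast
  show ?thesis
  proof (rule that[OF pos[of a]])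
    fix e assume "e \<le> h a"
    hence "trunc_powr p e (h t) = h t powr (p - 1)" for t using a[of t] by (simp add: trunc_powr_ge_powr)
    thus "truncated_solution p m M e h (deriv h)"
      unfolding truncated_solution_def using per d f unfolding eq
      by (auto intro!: exI[of _ "\<lambda>t. f t * h t powr (p - 1)"] mult_right_mono)
  qed
qed

text \<open>Regularity comes from the equation: \<open>h\<close> is Lipschitz and bounded away from
  zero, so \<open>h powr (p - 1)\<close> is Lipschitz and the second derivative is Hoelder
  continuous.\<close>

lemma positive_classical_solution_exists:
  assumes p: "-1 < p" "p \<le> 0" and \<alpha>: "0 < \<alpha>" "\<alpha> < 1"
    and f: "holder \<alpha> f" and pos: "\<And>t. 0 < f t"
  shows "\<exists>h. positive_classical_solution p \<alpha> f h"
proof -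
  have "circle_fun f" using f by (simp add: holder_def)
  then obtain h h1 where h: "circle_fun h" "\<And>t. 0 < h t" "\<And>t. (h has_real_derivative h1 t) (at t)"
    "\<And>t. (h1 has_real_derivative f t * h t powr (p - 1) - h t) (at t)"
    using periodic_solution_exists[OF p _ holder_continuous[OF f \<alpha>(1)] pos] by metis
  interpret h: periodic_fun_simple h "2 * pi" by fact
  have cont: "continuous_on UNIV h" using h(3) by (meson DERIV_isCont continuous_at_imp_continuous_on)
  obtain a where a: "\<And>t. h a \<le> h t" using circle_fun_attains_inf[OF h(1) cont] by blast
  have per1: "circle_fun h1" by (rule circle_fun_derivative[OF h(1,3)])
  obtain L where L: "\<And>t. \<bar>h1 t\<bar> \<le> L"
    using circle_fun_bounded[OF per1] h(4) by (meson DERIV_isCont continuous_at_imp_continuous_on)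
  have lip: "\<bar>h x - h y\<bar> \<le> L * \<bar>x - y\<bar>" for x y
    using field_differentiable_bound[of UNIV h h1 L x y] h(3) L by (auto simp: has_field_derivative_at_within)
  have "\<bar>h x powr (p - 1) - h y powr (p - 1)\<bar> \<le> (1 - p) * h a powr (p - 2) * L * \<bar>x - y\<bar>" for x y
  proof -
    \<comment> \<open>With the minimum of \<open>h\<close> as cut-off, the Lipschitz bound of the
      truncated power applies.\<close>
    have "\<bar>h x powr (p - 1) - h y powr (p - 1)\<bar> \<le> (1 - p) * h a powr (p - 2) * \<bar>h x - h y\<bar>"
      using trunc_powr_lipschitz[OF h(2)[of a] p(2), of "h x" "h y"] a by (simp add: trunc_powr_ge_powr)
    also have "\<dots> \<le> (1 - p) * h a powr (p - 2) * (L * \<bar>x - y\<bar>)"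
      using p lip by (intro mult_left_mono) auto
    finally show ?thesis by (simp add: mult.assoc)
  qed
  moreover have "circle_fun (\<lambda>t. h t powr (p - 1))" by unfold_locales (simp add: h.plus_1)
  ultimately have "holder \<alpha> (\<lambda>t. h t powr (p - 1))" using lipschitz_imp_holder \<alpha> by blast
  moreover have "holder \<alpha> h" using lipschitz_imp_holder[OF h(1) lip \<alpha>] .
  ultimately have H: "holder \<alpha> (\<lambda>t. f t * h t powr (p - 1) - h t)"
    using f \<alpha> by (intro holder_diff holder_mult)
  have d1: "deriv h = h1" using DERIV_imp_deriv[OF h(3)] by auto
  have d2: "deriv h1 = (\<lambda>t. f t * h t powr (p - 1) - h t)" using DERIV_imp_deriv[OF h(4)] by auto
  have "positive_classical_solution p \<alpha> f h"
    unfolding positive_classical_solution_def C2_holder_def d1 d2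
    using h H by (auto simp: real_differentiable_def)
  thus ?thesis by blast
qed

theorem theorem1p3:
  shows "(\<exists>C :: real \<Rightarrow> real \<Rightarrow> real \<Rightarrow> real.
            \<forall>p \<alpha> f. -1 < p \<and> p \<le> 0 \<and> 0 < \<alpha> \<and> \<alpha> < 1 \<and> holder \<alpha> f \<and> (\<forall>\<theta>. f \<theta> > 0) \<longrightarrow>
              C p (circle_min f) (holder_norm \<alpha> f) \<ge> 1 \<and>
              (\<forall>h. positive_classical_solution p \<alpha> f h \<longrightarrow>
                 (\<forall>\<theta>. inverse (C p (circle_min f) (holder_norm \<alpha> f)) \<le> h \<theta> \<and>
                      h \<theta> \<le> C p (circle_min f) (holder_norm \<alpha> f))))
       \<and> (\<forall>p \<alpha> f. -1 < p \<and> p \<le> 0 \<and> 0 < \<alpha> \<and> \<alpha> < 1 \<and> holder \<alpha> f \<and> (\<forall>\<theta>. f \<theta> > 0) \<longrightarrow>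
            (\<exists>h. positive_classical_solution p \<alpha> f h))"
proof -
  define Q where "Q = (\<lambda>p m M C. 1 \<le> C \<and> (\<forall>e h h1. 0 < e \<and> e \<le> 1 / C \<and> truncated_solution p m M e h h1 \<longrightarrow>
    (\<forall>t. 1 / C \<le> h t \<and> h t \<le> C \<and> \<bar>h1 t\<bar> \<le> C)))"
  \<comment> \<open>Choosing from \<open>p\<close>, \<open>m\<close> and \<open>M\<close> alone,
    before \<open>f\<close> and \<open>h\<close>, yields the required dependence.\<close>
  define C where "C = (\<lambda>p m M. SOME C. Q p m M C)"
  have Q: "Q p m M (C p m M)" if "-1 < p" "p \<le> 0" "0 < m" "m \<le> M" for p m M
    unfolding C_def using truncated_solution_bounds[OF that] by (intro someI_ex[of "Q p m M"]) (simp add: Q_def)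
  have "1 \<le> C p (circle_min f) (holder_norm \<alpha> f) \<and>
      (\<forall>h. positive_classical_solution p \<alpha> f h \<longrightarrow>
         (\<forall>\<theta>. inverse (C p (circle_min f) (holder_norm \<alpha> f)) \<le> h \<theta> \<and>
              h \<theta> \<le> C p (circle_min f) (holder_norm \<alpha> f)))"
    if p: "-1 < p" "p \<le> 0" and f: "0 < \<alpha>" "holder \<alpha> f" "\<And>t. 0 < f t" for p \<alpha> f
  proof -
    note b = holder_bounds[OF f(2,1,3)]
    define c where "c = C p (circle_min f) (holder_norm \<alpha> f)"
    have c: "Q p (circle_min f) (holder_norm \<alpha> f) c"
      unfolding c_def using b order_trans[OF b(2,3)] p by (intro Q) auto
    hence c1: "1 \<le> c" by (simp add: Q_def)
    have "inverse c \<le> h t \<and> h t \<le> c" if sol: "positive_classical_solution p \<alpha> f h" for h t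
    proof -
      obtain e0 where e0: "0 < e0"
        "\<And>e. e \<le> e0 \<Longrightarrow> truncated_solution p (circle_min f) (holder_norm \<alpha> f) e h (deriv h)"
        using positive_classical_solution_truncated[OF sol p(2) b(2,3)] by blast
      \<comment> \<open>This cut-off is small enough both to leave \<open>h\<close> untouched and to
        be admissible in the a priori bound.\<close>
      have "0 < min e0 (1 / c)" "min e0 (1 / c) \<le> 1 / c" using e0 c1 by auto
      thus ?thesis using c e0(2)[of "min e0 (1 / c)"] unfolding Q_def inverse_eq_divide by (meson min.cobounded1)
    qed
    thus ?thesis using c1 by (simp add: c_def)
  qed
  thus ?thesis using positive_classical_solution_exists by blast
qed

end
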